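(* Let $(H,\langle\cdot,\cdot\rangle_H)$ be a separable real Hilbert space, let $(\mathcal{F}_t)_{t\ge 0}$ be a filtration, let $(f_t)_{t\ge1}$ be an $H$-valued sequence that is $(\mathcal{F}_t)$-predictable (i.e. $f_t$ is $\mathcal{F}_{t-1}$-measurable) with $\|f_t\|_H<\infty$ for all $t$, and let $(\epsilon_t)_{t\ge1}$ be a real-valued $(\mathcal{F}_t)$-adapted sequence such that, conditionally on $\mathcal{F}_{t-1}$, $\epsilon_t$ is $\sigma$-subGaussian. Define $S_t:=\sum_{s=1}^t\epsilon_s f_s$ and $V_t:=\sum_{s=1}^t f_sf_s^\top$ (with $S_0=0$, $V_0=0$). Then for every $\rho>0$ the process \[ M_t:=\frac{1}{\sqrt{\det(\mathrm{id}_H+\rho^{-1}V_t)}}\exp\left\{\frac12\left\|(\rho\,\mathrm{id}_H+V_t)^{-1/2}S_t/\sigma\right\|_H^2\right\} \] is a non-negative supermartingale with respect to $(\mathcal{F}_t)_{t\ge0}$. Consequently, for every $\delta\in(0,1)$, with probability at least $1-\delta$, simultaneously for all $t\ge 1$, \[ \left\|(V_t+\rho\,\mathrm{id}_H)^{-1/2}S_t\right\|_H\le\sigma\sqrt{2\log\left(\frac1\delta\sqrt{\det(\mathrm{id}_H+\rho^{-1}V_t)}\right)}. \]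
   Context: For $f,g\in H$, $fg^\top$ denotes the rank-one operator $h\mapsto f\langle g,h\rangle_H$; $\mathrm{id}_H$ is the identity on $H$. A real random variable $\epsilon$ is $\sigma$-subGaussian conditioned on a $\sigma$-algebra $\mathcal{F}$ if $\log\mathbb{E}(e^{\lambda\epsilon}\mid\mathcal{F})\le\lambda^2\sigma^2/2$ for all $\lambda\in\mathbb{R}$. For a self-adjoint finite-rank operator $A$ on $H$ with nonzero eigenvalues $\lambda_1(A),\dots,\lambda_k(A)$, the Fredholm determinant is $\det(\mathrm{id}_H+A):=\prod_{i=1}^k(1+\lambda_i(A))$. *)

theory Defs
  imports "HOL-Probability.Probability"
begin

definition filtration :: "'a measure \<Rightarrow> (nat \<Rightarrow> 'a measure) \<Rightarrow> bool" where
  "filtration M F \<longleftrightarrow> (\<forall>t. subalgebra M (F t)) \<and> (\<forall>s t. s \<le> t \<longrightarrow> sets (F s) \<subseteq> sets (F t))"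

definition cond_subgaussian :: "'a measure \<Rightarrow> 'a measure \<Rightarrow> real \<Rightarrow> ('a \<Rightarrow> real) \<Rightarrow> bool" where
  "cond_subgaussian M G \<sigma> e \<longleftrightarrow>
     (\<forall>l::real. AE x in M. nn_cond_exp M G (\<lambda>y. ennreal (exp (l * e y))) x
                            \<le> ennreal (exp (l\<^sup>2 * \<sigma>\<^sup>2 / 2)))"

definition nonneg_supermartingale :: "'a measure \<Rightarrow> (nat \<Rightarrow> 'a measure) \<Rightarrow> (nat \<Rightarrow> 'a \<Rightarrow> real) \<Rightarrow> bool" where
  "nonneg_supermartingale M F X \<longleftrightarrow>
     (\<forall>t. X t \<in> borel_measurable (F t)) \<and>
     (\<forall>t. integrable M (X t)) \<and>
     (\<forall>t. \<forall>x\<in>space M. 0 \<le> X t x) \<and>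
     (\<forall>t. AE x in M. real_cond_exp M (F t) (X (Suc t)) x \<le> X t x)"

definition rank_one :: "'h::real_inner \<Rightarrow> 'h \<Rightarrow> 'h \<Rightarrow> 'h" where
  "rank_one f g = (\<lambda>h. inner g h *\<^sub>R f)"

text \<open>Fredholm determinant det(id + A) of a self-adjoint finite-rank operator A:
  product of (1 + lambda) over the nonzero eigenvalues, counted with multiplicity.\<close>
definition fredholm_det_id_plus :: "('h::real_inner \<Rightarrow> 'h) \<Rightarrow> real" where
  "fredholm_det_id_plus A =
     (\<Prod>\<mu>\<in>{\<mu>. \<mu> \<noteq> 0 \<and> (\<exists>x. x \<noteq> 0 \<and> A x = \<mu> *\<^sub>R x)}.
        (1 + \<mu>) ^ dim {x. A x = \<mu> *\<^sub>R x})"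

text \<open>Inverse square root A^{-1/2} of a bounded, self-adjoint, positive, invertible operator A:
  the unique bounded self-adjoint positive operator B with B o B = A^{-1}.\<close>
definition inv_sqrt_op :: "('h::real_inner \<Rightarrow> 'h) \<Rightarrow> ('h \<Rightarrow> 'h)" where
  "inv_sqrt_op A = (THE B. bounded_linear B \<and> (\<forall>x y. inner (B x) y = inner x (B y)) \<and>
       (\<forall>x. 0 \<le> inner (B x) x) \<and> (\<forall>x. B (B (A x)) = x \<and> A (B (B x)) = x))"

end

theory Submission
  imports Defs
begin

text \<open>Write \<open>R\<^sub>t = (\<rho> id + V\<^sub>t)\<^sup>-\<^sup>1\<close>, \<open>e = \<epsilon>\<^bsub>t+1\<^esub> / \<sigma>\<close>, \<open>q = \<langle>f\<^bsub>t+1\<^esub>, R\<^sub>t f\<^bsub>t+1\<^esub>\<rangle>\<close> and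
  \<open>a = \<langle>f\<^bsub>t+1\<^esub>, R\<^sub>t S\<^sub>t\<rangle> / \<sigma>\<close>. By the Sherman-Morrison formula and the determinant formula for rank-one
  updates, the process is multiplied in step \<open>t + 1\<close> by
  \<open>(1 + q)\<^sup>-\<^sup>1\<^sup>/\<^sup>2 exp ((2 e a + e\<^sup>2 q - a\<^sup>2) / (2 (1 + q)))\<close>. This factor is the average of
  \<open>exp (\<lambda> e - \<lambda>\<^sup>2 / 2)\<close> over a Gaussian \<open>\<lambda>\<close> with mean \<open>a\<close> and variance \<open>q\<close>, which are both known at
  time \<open>t\<close>, so its conditional expectation is at most 1 by sub-Gaussianity. The uniform bound is
  Ville's inequality. The Sherman-Morrison recursion also serves as the definition of \<open>R\<^sub>t\<close>, as it
  makes measurability evident.\<close>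

subsection \<open>Orthonormal sets and the spectral theorem in finite rank\<close>

text \<open>The numbers a and q come from Bayesian regression: if theta is Gaussian on H with mean
  R_t S_t / sigma and covariance R_t, the posterior for prior covariance id / rho, then <theta,
  f_{t+1}> has mean a and variance q. Mixing over theta all at once would be the classical route,
  but id / rho is not trace class in infinite dimension, so no such prior vector lives in H. Mixing
  over one real variable per step uses only one-dimensional integrals. Two obstacles shape the rest.
  Sub-Gaussianity holds for each fixed exponent outside a null set that depends on the exponent,
  whereas the exponents drawn here are random; they are reached through simple functions and a
  limit. Moreover, the determinant and the inverse square root are given by eigenvalues and a
  definite description, which say nothing about measurability. Finite-rank spectral theory serves
  only to rewrite both in terms of the resolvent.\<close>

definition orthonormal :: "'h::real_inner set \<Rightarrow> bool" where
  "orthonormal U \<longleftrightarrow> (\<forall>u\<in>U. \<forall>v\<in>U. u \<bullet> v = (if u = v then 1 else 0))"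

lemma orthonormal_inner:
  "orthonormal U \<Longrightarrow> u \<in> U \<Longrightarrow> v \<in> U \<Longrightarrow> u \<bullet> v = (if u = v then 1 else 0)"
  by (auto simp: orthonormal_def)

lemma orthonormal_inner_sum:
  assumes "finite U" "orthonormal U" "u \<in> U"
  shows "u \<bullet> (\<Sum>v\<in>U. c v *\<^sub>R v) = c u"
proof -
  have "u \<bullet> (\<Sum>v\<in>U. c v *\<^sub>R v) = (\<Sum>v\<in>U. if u = v then c v else 0)"
    unfolding inner_sum_right using assms by (intro sum.cong) (auto simp: orthonormal_inner)
  then show ?thesis using assms by simp
qed

lemma orthonormal_expansion:
  assumes "finite U" "orthonormal U" "h \<in> span U"
  shows "(\<Sum>u\<in>U. (u \<bullet> h) *\<^sub>R u) = h"
proof -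
  obtain c where h: "h = (\<Sum>u\<in>U. c u *\<^sub>R u)"
    using assms(1,3) by (auto simp: span_finite)
  have "u \<bullet> h = c u" if "u \<in> U" for u
    using assms that by (simp add: h orthonormal_inner_sum)
  then show ?thesis by (simp add: h)
qed

lemma orthonormal_parseval:
  assumes "finite U" "orthonormal U" "x \<in> span U"
  shows "x \<bullet> y = (\<Sum>u\<in>U. (u \<bullet> x) * (u \<bullet> y))"
  by (subst orthonormal_expansion[OF assms, symmetric]) (simp add: inner_sum_left)

lemma orthonormal_sum_in_span: "(\<Sum>u\<in>U. c u *\<^sub>R u) \<in> span U"
  by (intro span_sum span_scale span_base)

lemma orthonormal_residual:
  assumes "finite U" "orthonormal U" "u \<in> U"
  shows "u \<bullet> (h - (\<Sum>u\<in>U. (u \<bullet> h) *\<^sub>R u)) = 0"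
  using assms by (simp add: inner_diff_right orthonormal_inner_sum)

lemma orthonormal_independent:
  assumes "orthonormal U" shows "independent U"
proof (rule pairwise_orthogonal_independent)
  show "pairwise orthogonal U"
    using assms by (auto simp: pairwise_def orthogonal_def orthonormal_def)
  show "0 \<notin> U"
    using assms by (force simp: orthonormal_def)
qed

lemma exists_orthonormal_basis:
  fixes B :: "'h::real_inner set"
  assumes "finite B"
  obtains U where "finite U" "orthonormal U" "span U = span B"
proof -
  obtain C where C: "finite C" "span C = span B" "pairwise orthogonal C"
    using basis_orthogonal[OF assms] by blast
  define U where "U = (\<lambda>x. (1 / norm x) *\<^sub>R x) ` (C - {0})"
  have "((1 / norm x) *\<^sub>R x) \<bullet> ((1 / norm y) *\<^sub>R y) = (if x = y then 1 else 0)"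
    if "x \<in> C - {0}" "y \<in> C - {0}" for x y
    using that C(3) by (auto simp: pairwise_def orthogonal_def dot_square_norm power2_eq_square)
  \<comment> \<open>Distinct vectors with the same image would give that image the inner product 0
    with itself, but it is 1.\<close>
  moreover from this have "inj_on (\<lambda>x. (1 / norm x) *\<^sub>R x) (C - {0})"
    by (metis (no_types, lifting) inj_onI zero_neq_one)
  ultimately have "orthonormal U"
    unfolding orthonormal_def U_def by (auto simp del: inner_scaleR_left inner_scaleR_right dest: inj_onD)
  moreover have "span U = span C"
  proof (rule span_eq[THEN iffD2], intro conjI subsetI)
    show "x \<in> span C" if "x \<in> U" for x
      using that by (auto simp: U_def intro: span_scale[OF span_base])
    show "x \<in> span U" if "x \<in> C" for x
    proof (cases "x = 0")
      case False
      then have "x = norm x *\<^sub>R ((1 / norm x) *\<^sub>R x)" by simp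
      moreover have "(1 / norm x) *\<^sub>R x \<in> U" using False that by (auto simp: U_def)
      ultimately show ?thesis by (metis span_scale span_base)
    qed (simp add: span_zero)
  qed
  moreover have "finite U" using C(1) by (simp add: U_def)
  ultimately show thesis using that C(2) by metis
qed

text \<open>Closed bounded sets of an infinite-dimensional space need not be compact. Here
  compactness is built up one dimension at a time: a further vector adds a compact segment in the
  sense of Minkowski sums.\<close>

lemma compact_unit_combinations:
  fixes U :: "'h::real_inner set"
  assumes "finite U"
  shows "compact {\<Sum>u\<in>U. c u *\<^sub>R u |c. \<forall>u\<in>U. \<bar>c u\<bar> \<le> (1::real)}"
  using assms
proof induction
  case (insert a U)
  let ?K = "\<lambda>U. {\<Sum>u\<in>U. c u *\<^sub>R u |c. \<forall>u\<in>U. \<bar>c u\<bar> \<le> (1::real)}"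
  have "?K (insert a U) = {x + y |x y. x \<in> ?K U \<and> y \<in> (\<lambda>r. r *\<^sub>R a) ` {-1..1}}" (is "?L = ?R")
  proof (intro equalityI subsetI)
    fix x assume "x \<in> ?L"
    then obtain c where c: "\<forall>u\<in>insert a U. \<bar>c u\<bar> \<le> (1::real)" "x = (\<Sum>u\<in>insert a U. c u *\<^sub>R u)" by blast
    then have "x = (\<Sum>u\<in>U. c u *\<^sub>R u) + c a *\<^sub>R a" using insert by (simp add: add.commute)
    moreover have "(\<Sum>u\<in>U. c u *\<^sub>R u) \<in> ?K U" using c by auto
    moreover have "c a *\<^sub>R a \<in> (\<lambda>r. r *\<^sub>R a) ` {-1..1}" using c by (auto simp: abs_le_iff)
    ultimately show "x \<in> ?R" by blast
  next
    fix x assume "x \<in> ?R"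
    then obtain c r where c: "\<forall>u\<in>U. \<bar>c u\<bar> \<le> (1::real)" "r \<in> {-1..1}"
      "x = (\<Sum>u\<in>U. c u *\<^sub>R u) + r *\<^sub>R a" by blast
    have "(\<Sum>u\<in>U. c u *\<^sub>R u) = (\<Sum>u\<in>U. (c(a := r)) u *\<^sub>R u)"
      using insert by (intro sum.cong) auto
    then have "x = (\<Sum>u\<in>insert a U. (c(a := r)) u *\<^sub>R u)" using insert c by (simp add: add.commute)
    moreover have "\<forall>u\<in>insert a U. \<bar>(c(a := r)) u\<bar> \<le> 1" using c by (auto simp: abs_le_iff)
    ultimately show "x \<in> ?L" by blast
  qed
  moreover have "compact ((\<lambda>r. r *\<^sub>R a) ` {-1..1::real})"
    by (intro compact_continuous_image continuous_intros compact_Icc)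
  ultimately show ?case using compact_sums[OF insert.IH] by simp
qed simp

text \<open>Cauchy-Schwarz bounds the coordinates of a unit vector by 1, so this sphere is a closed
  part of the compact set of bounded combinations.\<close>

lemma compact_sphere_span:
  fixes U :: "'h::real_inner set"
  assumes "finite U" "orthonormal U"
  shows "compact (sphere 0 1 \<inter> span U)"
proof -
  let ?K = "{\<Sum>u\<in>U. c u *\<^sub>R u |c. \<forall>u\<in>U. \<bar>c u\<bar> \<le> (1::real)}"
  have "sphere 0 1 \<inter> span U = sphere 0 1 \<inter> ?K"
  proof (intro equalityI subsetI)
    fix x assume x: "x \<in> sphere 0 1 \<inter> span U"
    have "\<bar>u \<bullet> x\<bar> \<le> 1" if "u \<in> U" for u
    proof -
      have "norm u = 1" using assms that by (simp add: norm_eq_1 orthonormal_inner)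
      then show ?thesis using x Cauchy_Schwarz_ineq2[of u x] by simp
    qed
    then show "x \<in> sphere 0 1 \<inter> ?K"
      using orthonormal_expansion[OF assms, of x] x by (auto intro!: exI[of _ "\<lambda>u. u \<bullet> x"])
  qed (auto intro: orthonormal_sum_in_span)
  also have "compact \<dots>"
    using compact_unit_combinations[OF assms(1)]
    by (intro closed_Int_compact) (auto simp: sphere_def intro!: closed_Collect_eq continuous_intros)
  finally show ?thesis .
qed

text \<open>First variation of the Rayleigh quotient: the residual \<open>T x - l x\<close> is
  orthogonal to \<open>x\<close>, and a small move along it would beat the maximum at first order
  unless it vanishes.\<close>

lemma max_quadratic_form_eigenvector:
  fixes T :: "'h::real_inner \<Rightarrow> 'h"
  assumes T: "linear T" and sym: "\<And>x y. T x \<bullet> y = x \<bullet> T y"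
    and W: "subspace W" and inv: "\<And>x. x \<in> W \<Longrightarrow> T x \<in> W"
    and x: "x \<in> W" "norm x = 1"
    and max: "\<And>z. z \<in> W \<Longrightarrow> norm z = 1 \<Longrightarrow> T z \<bullet> z \<le> T x \<bullet> x"
  shows "T x = (T x \<bullet> x) *\<^sub>R x"
proof -
  define l where "l = T x \<bullet> x"
  define y where "y = T x - l *\<^sub>R x"
  \<comment> \<open>Homogeneity removes the restriction to unit vectors, so the perturbed vector
    need not be normalised.\<close>
  have le: "T z \<bullet> z \<le> l * (z \<bullet> z)" if "z \<in> W" for z
  proof (cases "z = 0")
    case False
    have "T ((1 / norm z) *\<^sub>R z) \<bullet> ((1 / norm z) *\<^sub>R z) \<le> l"
      unfolding l_def using False that W by (intro max) (auto simp: subspace_scale)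
    then show ?thesis
      using False by (simp add: linear_scale[OF T] field_simps power2_norm_eq_inner[symmetric] power2_eq_square)
  qed (simp add: linear_0[OF T])
  have yW: "y \<in> W" unfolding y_def using x W inv by (simp add: subspace_diff subspace_scale)
  have xx: "x \<bullet> x = 1" using x by (simp add: norm_eq_1)
  have yx: "x \<bullet> y = 0" by (simp add: y_def inner_diff_right l_def xx inner_commute)
  have Txy: "T x \<bullet> y = y \<bullet> y"
  proof -
    have "T x = y + l *\<^sub>R x" by (simp add: y_def)
    then show ?thesis by (simp add: inner_add_left yx)
  qed
  have key: "2 * s * (y \<bullet> y) + s\<^sup>2 * (T y \<bullet> y) \<le> l * s\<^sup>2 * (y \<bullet> y)" for s :: real
  proof -
    have "x + s *\<^sub>R y \<in> W" using x yW W by (simp add: subspace_add subspace_scale)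
    from le[OF this] show ?thesis
      by (simp add: linear_add[OF T] linear_scale[OF T] inner_add_left inner_add_right xx yx Txy
          inner_commute[of y x] sym[of y x] l_def[symmetric] inner_commute[of y "T x"] power2_eq_square algebra_simps)
  qed
  have "y \<bullet> y = 0"
  proof (rule ccontr)
    assume "y \<bullet> y \<noteq> 0"
    then have pos: "y \<bullet> y > 0" by (metis inner_ge_zero less_eq_real_def)
    \<comment> \<open>\<open>K\<close> bounds the second-order coefficient and is positive by the
      added 1. The choice of \<open>s\<close> below makes the second-order gain at most |y|^2,
      against the required 2 |y|^2.\<close>
    define K where "K = \<bar>l * (y \<bullet> y) - T y \<bullet> y\<bar> + 1"
    have K: "K > 0" "l * (y \<bullet> y) - T y \<bullet> y \<le> K" by (auto simp: K_def)
    define s where "s = (y \<bullet> y) / K"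
    have s: "s > 0" using pos K by (simp add: s_def)
    have "s * (2 * (y \<bullet> y)) \<le> s * (s * (l * (y \<bullet> y) - T y \<bullet> y))"
      using key[of s] by (simp add: power2_eq_square algebra_simps)
    then have "2 * (y \<bullet> y) \<le> s * (l * (y \<bullet> y) - T y \<bullet> y)" using s by (simp only: mult_le_cancel_left_pos)
    also have "\<dots> \<le> s * K" using s K by (intro mult_left_mono) auto
    also have "\<dots> = y \<bullet> y" using K by (simp add: s_def)
    finally show False using pos by simp
  qed
  then show ?thesis by (simp add: y_def l_def)
qed

text \<open>A maximal orthonormal set of eigenvectors spans, since otherwise the quadratic form
  attains its maximum on the unit sphere of the orthogonal complement at a further eigenvector.\<close>
lemma spectral_theorem_finite_span:
  fixes T :: "'h::real_inner \<Rightarrow> 'h" and B :: "'h set"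
  assumes T: "linear T" and sym: "\<And>x y. T x \<bullet> y = x \<bullet> T y"
    and B: "finite B" and inv: "\<And>x. x \<in> span B \<Longrightarrow> T x \<in> span B"
  obtains U where "finite U" "orthonormal U" "span U = span B"
    "\<And>u. u \<in> U \<Longrightarrow> T u = (T u \<bullet> u) *\<^sub>R u"
proof -
  define P where "P U \<longleftrightarrow> orthonormal U \<and> U \<subseteq> span B \<and> (\<forall>u\<in>U. T u = (T u \<bullet> u) *\<^sub>R u)" for U
  \<comment> \<open>Orthonormal sets are independent, so their size in the span is bounded and one
    of greatest cardinality exists.\<close>
  have bound: "finite U \<and> card U \<le> card B" if "P U" for U
    using independent_span_bound[OF B orthonormal_independent] that by (auto simp: P_def)
  have "P {}" by (simp add: P_def orthonormal_def)
  moreover have "\<forall>U. P U \<longrightarrow> card U < Suc (card B)" using bound by (simp add: le_imp_less_Suc)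
  ultimately obtain U where U: "P U" and greatest: "\<And>U'. P U' \<Longrightarrow> card U' \<le> card U"
    using ex_has_greatest_nat[of P "{}" card "Suc (card B)"] by auto
  have fin: "finite U" and on: "orthonormal U" and sub: "U \<subseteq> span B"
    and eig: "\<And>u. u \<in> U \<Longrightarrow> T u = (T u \<bullet> u) *\<^sub>R u"
    using U bound by (auto simp: P_def)
  have "span B \<subseteq> span U"
  proof (rule ccontr)
    assume "\<not> span B \<subseteq> span U"
    then obtain h where h: "h \<in> span B" "h \<notin> span U" by blast
    define W where "W = span B \<inter> {x. \<forall>u\<in>U. u \<bullet> x = 0}"
    have W: "subspace W"
        unfolding W_def
      by (intro subspace_inter subspace_span) (auto simp: subspace_def inner_add_right)
    have invW: "T x \<in> W" if "x \<in> W" for x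
    proof -
      have "u \<bullet> T x = 0" if u: "u \<in> U" for u
      proof -
        have "u \<bullet> T x = T u \<bullet> x" by (simp add: sym)
        also have "\<dots> = (T u \<bullet> u) * (u \<bullet> x)" by (subst eig[OF u]) simp
        finally show ?thesis using \<open>x \<in> W\<close> u by (simp add: W_def)
      qed
      then show ?thesis using that inv by (auto simp: W_def)
    qed
    \<comment> \<open>The residual of a vector outside \<open>span U\<close> is a nonzero element of
      the complement, so its unit sphere is nonempty.\<close>
    define w where "w = h - (\<Sum>u\<in>U. (u \<bullet> h) *\<^sub>R u)"
    have "(\<Sum>u\<in>U. (u \<bullet> h) *\<^sub>R u) \<in> span B"
      using sub by (intro span_sum span_scale) auto
    then have "w \<in> W"
      using h fin on by (auto simp: W_def w_def orthonormal_residual intro: span_diff)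
    moreover have "w \<noteq> 0"
      using h(2) orthonormal_sum_in_span[of "\<lambda>u. u \<bullet> h" U] by (auto simp: w_def)
    ultimately have "(1 / norm w) *\<^sub>R w \<in> sphere 0 1 \<inter> W"
      using W by (auto simp: subspace_scale)
    then have ne: "sphere 0 1 \<inter> W \<noteq> {}" by blast
    obtain E where E: "finite E" "orthonormal E" "span E = span B"
      using exists_orthonormal_basis[OF B] by blast
    have "closed {x. \<forall>u\<in>U. u \<bullet> x = 0}"
      unfolding Collect_ball_eq by (intro closed_INT ballI closed_Collect_eq continuous_intros)
    then have "compact ((sphere 0 1 \<inter> span E) \<inter> {x. \<forall>u\<in>U. u \<bullet> x = 0})"
      using compact_sphere_span[OF E(1,2)] by (rule compact_Int_closed[rotated])
    then have comp: "compact (sphere 0 1 \<inter> W)" by (simp add: W_def E Int_assoc)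
    \<comment> \<open>Source of continuity: on a finite-dimensional span a linear map is a finite
      sum of continuous maps.\<close>
    have TE: "T x = (\<Sum>e\<in>E. (e \<bullet> x) *\<^sub>R T e)" if "x \<in> W" for x
    proof -
      have "x \<in> span E" using that by (simp add: W_def E)
      from arg_cong[OF orthonormal_expansion[OF E(1,2) this], of T]
      show ?thesis by (simp add: linear_sum[OF T] linear_scale[OF T])
    qed
    have "continuous_on (sphere 0 1 \<inter> W) (\<lambda>x. (\<Sum>e\<in>E. (e \<bullet> x) *\<^sub>R T e) \<bullet> x)"
      by (intro continuous_intros)
    then have "continuous_on (sphere 0 1 \<inter> W) (\<lambda>x. T x \<bullet> x)"
      by (rule continuous_on_eq) (auto simp: TE[symmetric])
    from continuous_attains_sup[OF comp ne this]
    obtain x where x: "x \<in> W" "norm x = 1" "\<And>z. z \<in> W \<Longrightarrow> norm z = 1 \<Longrightarrow> T z \<bullet> z \<le> T x \<bullet> x"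
      by auto
    then have "T x = (T x \<bullet> x) *\<^sub>R x"
      using max_quadratic_form_eigenvector[OF T sym W invW] by blast
    then have "P (insert x U)"
      using x(1,2) on sub eig
      by (auto simp: P_def W_def orthonormal_def norm_eq_1 inner_commute)
    moreover have "x \<notin> U" using x(1,2) by (auto simp: W_def)
    ultimately show False using greatest[of "insert x U"] fin by auto
  qed
  then have "span U = span B" using sub by (metis span_mono span_span subset_antisym)
  then show thesis using that fin on eig by blast
qed

subsection \<open>Fredholm determinant and inverse square root in an eigenbasis\<close>

lemma spectral_representation:
  fixes T :: "'h::real_inner \<Rightarrow> 'h"
  assumes sym: "\<And>x y. T x \<bullet> y = x \<bullet> T y"
    and U: "finite U" "orthonormal U" and range: "\<And>h. T h \<in> span U"
    and eig: "\<And>u. u \<in> U \<Longrightarrow> T u = \<mu> u *\<^sub>R u"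
  shows "T h = (\<Sum>u\<in>U. (\<mu> u * (u \<bullet> h)) *\<^sub>R u)"
proof -
  have "T h = (\<Sum>u\<in>U. (u \<bullet> T h) *\<^sub>R u)" using orthonormal_expansion[OF U range] by simp
  also have "\<dots> = (\<Sum>u\<in>U. (\<mu> u * (u \<bullet> h)) *\<^sub>R u)"
    by (intro sum.cong refl) (simp add: sym[symmetric] eig)
  finally show ?thesis .
qed

text \<open>An eigenvector for a nonzero eigenvalue lies in the range of \<open>T\<close>, hence in
  \<open>span U\<close>, and comparing coordinates leaves only those with the right eigenvalue. For
  \<open>l = 0\<close> the orthogonal complement of \<open>U\<close> would have to be added.\<close>

lemma eigenspace_eq_span:
  fixes T :: "'h::real_inner \<Rightarrow> 'h"
  assumes U: "finite U" "orthonormal U" and T: "\<And>h. T h = (\<Sum>u\<in>U. (\<mu> u * (u \<bullet> h)) *\<^sub>R u)"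
    and l: "l \<noteq> 0"
  shows "{x. T x = l *\<^sub>R x} = span {u\<in>U. \<mu> u = l}"
proof (intro equalityI subsetI)
  fix x assume "x \<in> {x. T x = l *\<^sub>R x}"
  then have x: "T x = l *\<^sub>R x" by simp
  have "\<mu> u * (u \<bullet> x) = l * (u \<bullet> x)" if "u \<in> U" for u
    using orthonormal_inner_sum[OF U that, of "\<lambda>u. \<mu> u * (u \<bullet> x)"] x by (auto simp: T[symmetric])
  then have "\<mu> u = l \<or> u \<bullet> x = 0" if "u \<in> U" for u using that by (metis mult_right_cancel)
  then have *: "(\<mu> u * (u \<bullet> x)) *\<^sub>R u \<in> span {u\<in>U. \<mu> u = l}" if "u \<in> U" for u
    using that by (cases "u \<bullet> x = 0") (auto intro: span_scale[OF span_base] simp: span_zero)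
  have "x = (1 / l) *\<^sub>R T x" using x l by simp
  also have "\<dots> \<in> span {u\<in>U. \<mu> u = l}"
    unfolding T by (intro span_scale span_sum *)
  finally show "x \<in> span {u\<in>U. \<mu> u = l}" .
next
  have "T u = \<mu> u *\<^sub>R u" if "u \<in> U" for u
  proof -
    have "T u = (\<Sum>v\<in>U. if v = u then \<mu> u *\<^sub>R u else 0)"
      unfolding T using U that by (intro sum.cong) (auto simp: orthonormal_inner)
    then show ?thesis using U that by simp
  qed
  moreover have "T (x + y) = T x + T y" "T (c *\<^sub>R x) = c *\<^sub>R T x" for x y c
    by (simp_all add: T inner_add_right distrib_left scaleR_add_left sum.distrib scaleR_sum_right
        mult.left_commute)
  then have "subspace {x. T x = l *\<^sub>R x}"
    by (auto simp: subspace_def scaleR_add_right scaleR_left_commute) (simp add: T)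
  ultimately have "span {u\<in>U. \<mu> u = l} \<subseteq> {x. T x = l *\<^sub>R x}"
    by (intro span_minimal) auto
  then show "x \<in> {x. T x = l *\<^sub>R x}" if "x \<in> span {u\<in>U. \<mu> u = l}" for x
    using that by blast
qed

text \<open>Grouping \<open>U\<close> by eigenvalue turns multiplicities into dimensions of
  eigenspaces. \<open>U\<close> may contain vectors of eigenvalue 0, which contribute the factor 1;
  this allows operators of different rank to be compared over bases of one common span.\<close>

lemma fredholm_det_eigenbasis:
  fixes T :: "'h::real_inner \<Rightarrow> 'h"
  assumes U: "finite U" "orthonormal U" and T: "\<And>h. T h = (\<Sum>u\<in>U. (\<mu> u * (u \<bullet> h)) *\<^sub>R u)"
  shows "fredholm_det_id_plus T = (\<Prod>u\<in>U. 1 + \<mu> u)"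
proof -
  note es = eigenspace_eq_span[OF U T]
  have on: "orthonormal {u\<in>U. \<mu> u = l}" for l using U(2) by (auto simp: orthonormal_def)
  have dim: "dim {x. T x = l *\<^sub>R x} = card {u\<in>U. \<mu> u = l}" if "l \<noteq> 0" for l
    unfolding es[OF that] by (intro dim_span_eq_card_independent orthonormal_independent on)
  have ev: "{l. l \<noteq> 0 \<and> (\<exists>x. x \<noteq> 0 \<and> T x = l *\<^sub>R x)} = \<mu> ` U - {0}"
  proof (intro equalityI subsetI)
    fix l assume "l \<in> {l. l \<noteq> 0 \<and> (\<exists>x. x \<noteq> 0 \<and> T x = l *\<^sub>R x)}"
    then obtain x where x: "l \<noteq> 0" "x \<noteq> 0" "T x = l *\<^sub>R x" by blast
    then have "x \<in> span {u\<in>U. \<mu> u = l}" using es[of l] by blast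
    with x(2) have "{u\<in>U. \<mu> u = l} \<noteq> {}" by (metis span_empty singletonD)
    then show "l \<in> \<mu> ` U - {0}" using x by auto
  next
    fix l assume "l \<in> \<mu> ` U - {0}"
    then obtain u where u: "u \<in> U" "\<mu> u = l" "l \<noteq> 0" by auto
    then have "T u = l *\<^sub>R u" using es[of l] span_base[of u "{u\<in>U. \<mu> u = l}"] by blast
    moreover have "u \<noteq> 0" using orthonormal_inner[OF U(2) u(1) u(1)] by auto
    ultimately show "l \<in> {l. l \<noteq> 0 \<and> (\<exists>x. x \<noteq> 0 \<and> T x = l *\<^sub>R x)}" using u by blast
  qed
  have "fredholm_det_id_plus T = (\<Prod>l\<in>\<mu> ` U - {0}. (1 + l) ^ card {u\<in>U. \<mu> u = l})"
    unfolding fredholm_det_id_plus_def ev by (intro prod.cong) (auto simp: dim)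
  also have "\<dots> = (\<Prod>l\<in>\<mu> ` U. (1 + l) ^ card {u\<in>U. \<mu> u = l})"
    using U by (intro prod.mono_neutral_left) auto
  also have "\<dots> = (\<Prod>l\<in>\<mu> ` U. \<Prod>u | u \<in> U \<and> \<mu> u = l. 1 + \<mu> u)"
    by (intro prod.cong) auto
  also have "\<dots> = (\<Prod>u\<in>U. 1 + \<mu> u)" using prod.image_gen[OF U(1)] by metis
  finally show ?thesis .
qed

text \<open>The matrix determinant lemma without determinants: both sides are 1 at \<open>\<tau> = 0\<close>, and their
  logarithmic derivatives agree by the Sherman-Morrison formula for the resolvent, as the trace of
  an operator may be computed in either of the two eigenbases.\<close>
lemma prod_eigenvalues_rank_one_update:
  fixes T T' :: "'h::real_inner \<Rightarrow> 'h"
  assumes U: "finite U" "orthonormal U" and U': "finite U'" "orthonormal U'"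
    and span: "span U' = span U" and f: "f \<in> span U"
    and T: "\<And>h. T h = (\<Sum>u\<in>U. (\<mu> u * (u \<bullet> h)) *\<^sub>R u)"
    and T': "\<And>v. v \<in> U' \<Longrightarrow> T v + (f \<bullet> v) *\<^sub>R f = \<mu>' v *\<^sub>R v"
    and \<mu>: "\<And>u. u \<in> U \<Longrightarrow> 0 \<le> \<mu> u" and \<mu>': "\<And>v. v \<in> U' \<Longrightarrow> 0 \<le> \<mu>' v"
    and \<tau>: "\<tau> > 0"
  shows "(\<Prod>v\<in>U'. 1 + \<tau> * \<mu>' v)
       = (\<Prod>u\<in>U. 1 + \<tau> * \<mu> u) * (1 + \<tau> * (\<Sum>u\<in>U. (u \<bullet> f)\<^sup>2 / (1 + \<tau> * \<mu> u)))"
proof -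
  \<comment> \<open>\<open>g s\<close> is 1 + s <f, (id + s T)^-1 f>, the expected quotient of the
    two products at parameter \<open>s\<close>.\<close>
  define g where "g s = 1 + s * (\<Sum>u\<in>U. (u \<bullet> f)\<^sup>2 / (1 + s * \<mu> u))" for s
  have pos: "1 + s * \<mu> u > 0" if "u \<in> U" "0 \<le> s" for u s
    using \<mu>[OF that(1)] that(2) by (simp add: add_pos_nonneg)
  have pos': "1 + s * \<mu>' v > 0" if "v \<in> U'" "0 \<le> s" for v s
    using \<mu>'[OF that(1)] that(2) by (simp add: add_pos_nonneg)
  have gpos: "g s > 0" if "0 \<le> s" for s
    unfolding g_def using pos[OF _ that] that
    by (intro add_pos_nonneg mult_nonneg_nonneg sum_nonneg divide_nonneg_nonneg) (auto simp: less_imp_le)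
  define L where "L s = (\<Sum>v\<in>U'. ln (1 + s * \<mu>' v)) - (\<Sum>u\<in>U. ln (1 + s * \<mu> u)) - ln (g s)" for s
  have uv: "(\<Sum>v\<in>U'. (u \<bullet> v)\<^sup>2) = 1" if "u \<in> U" for u
    using orthonormal_parseval[OF U', of u u] that span span_base[of u U] U
    by (simp add: orthonormal_inner power2_eq_square inner_commute)
  have vu: "(\<Sum>u\<in>U. (u \<bullet> v)\<^sup>2) = 1" if "v \<in> U'" for v
    using orthonormal_parseval[OF U, of v v] that span span_base[of v U'] U'
    by (simp add: orthonormal_inner power2_eq_square)
  \<comment> \<open>Both sizes equal the double sum of squared inner products between the two
    bases.\<close>
  have card: "real (card U') = real (card U)"
  proof -
    have "real (card U') = (\<Sum>v\<in>U'. \<Sum>u\<in>U. (u \<bullet> v)\<^sup>2)" by (simp add: vu)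
    also have "\<dots> = (\<Sum>u\<in>U. \<Sum>v\<in>U'. (u \<bullet> v)\<^sup>2)" by (rule sum.swap)
    also have "\<dots> = real (card U)" by (simp add: uv)
    finally show ?thesis .
  qed
  have trace: "(\<Sum>v\<in>U'. \<mu>' v / (1 + s * \<mu>' v)) - (\<Sum>u\<in>U. \<mu> u / (1 + s * \<mu> u))
      = (\<Sum>u\<in>U. (u \<bullet> f)\<^sup>2 / (1 + s * \<mu> u)\<^sup>2) / g s" if s: "s > 0" for s
  proof -
    \<comment> \<open>On the span, \<open>R\<close> is the inverse of id + s T.\<close>
    define R where "R h = (\<Sum>u\<in>U. ((u \<bullet> h) / (1 + s * \<mu> u)) *\<^sub>R u)" for h
    have uR: "u \<bullet> R h = (u \<bullet> h) / (1 + s * \<mu> u)" if "u \<in> U" for u h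
      unfolding R_def using orthonormal_inner_sum[OF U that] .
    have Rspan: "R h \<in> span U" for h unfolding R_def by (rule orthonormal_sum_in_span)
    have gR: "g s = 1 + s * (f \<bullet> R f)"
      unfolding g_def by (subst orthonormal_parseval[OF U f]) (simp add: uR power2_eq_square)
    \<comment> \<open>The diagonal entry at \<open>v\<close> of the Sherman-Morrison formula for (id
      + s T')^-1, where T' is the updated operator.\<close>
    have step: "1 / (1 + s * \<mu>' v) = v \<bullet> R v - s * (R f \<bullet> v)\<^sup>2 / g s" if v: "v \<in> U'" for v
    proof -
      have vs: "v \<in> span U" using v span span_base by metis
      \<comment> \<open>Obtained by applying \<open>R\<close> to (1 + s \<mu>' v) v = (id + s T) v +
        s <f, v> f.\<close>
      have Rv: "(1 + s * \<mu>' v) * (u \<bullet> R v) = u \<bullet> v + s * (f \<bullet> v) * (u \<bullet> R f)" if u: "u \<in> U" for u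
      proof -
        have "\<mu>' v * (u \<bullet> v) = u \<bullet> (T v + (f \<bullet> v) *\<^sub>R f)" by (simp add: T'[OF v])
        also have "\<dots> = \<mu> u * (u \<bullet> v) + (f \<bullet> v) * (u \<bullet> f)"
          by (simp add: inner_add_right T orthonormal_inner_sum[OF U u])
        finally have e: "\<mu>' v * (u \<bullet> v) = \<mu> u * (u \<bullet> v) + (f \<bullet> v) * (u \<bullet> f)" .
        have "(1 + s * \<mu>' v) * (u \<bullet> v) = (u \<bullet> v) + s * (\<mu>' v * (u \<bullet> v))" by (simp add: algebra_simps)
        also have "\<dots> = (1 + s * \<mu> u) * (u \<bullet> v) + s * (f \<bullet> v) * (u \<bullet> f)"
          unfolding e by (simp add: algebra_simps)
        finally show ?thesis
          using pos[OF u, of s] s by (simp add: uR[OF u] field_simps)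
      qed
      have par: "(1 + s * \<mu>' v) * (y \<bullet> R v) = y \<bullet> v + s * (f \<bullet> v) * (y \<bullet> R f)" if y: "y \<in> span U" for y
      proof -
        have "(1 + s * \<mu>' v) * (y \<bullet> R v) = (\<Sum>u\<in>U. (u \<bullet> y) * ((1 + s * \<mu>' v) * (u \<bullet> R v)))"
          unfolding orthonormal_parseval[OF U y] sum_distrib_left by (simp add: mult_ac)
        also have "\<dots> = (\<Sum>u\<in>U. (u \<bullet> y) * (u \<bullet> v)) + s * (f \<bullet> v) * (\<Sum>u\<in>U. (u \<bullet> y) * (u \<bullet> R f))"
          unfolding sum_distrib_left sum.distrib[symmetric]
          by (intro sum.cong refl) (subst Rv, auto simp: algebra_simps)
        finally show ?thesis unfolding orthonormal_parseval[OF U y, symmetric] .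
      qed
      have sym: "v \<bullet> R f = f \<bullet> R v"
        unfolding orthonormal_parseval[OF U vs] orthonormal_parseval[OF U f]
        by (intro sum.cong) (auto simp: uR)
      have 1: "(1 + s * \<mu>' v) * (v \<bullet> R f) = (f \<bullet> v) * g s"
        using par[OF f] by (simp add: sym gR algebra_simps)
      have 2: "(1 + s * \<mu>' v) * (v \<bullet> R v) = 1 + s * (f \<bullet> v) * (v \<bullet> R f)"
        using par[OF vs] U' v by (simp add: orthonormal_inner)
      have p: "1 + s * \<mu>' v \<noteq> 0" using pos'[OF v, of s] s by simp
      have gs: "g s \<noteq> 0" using gpos[of s] s by simp
      have "(1 + s * \<mu>' v) * (v \<bullet> R v - s * (R f \<bullet> v)\<^sup>2 / g s)
          = 1 + s * (f \<bullet> v) * (v \<bullet> R f) - s * ((1 + s * \<mu>' v) * (v \<bullet> R f)) * (v \<bullet> R f) / g s"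
        unfolding right_diff_distrib 2 by (simp add: power2_eq_square inner_commute)
      also have "\<dots> = 1" unfolding 1 using gs by simp
      finally show ?thesis using p by (simp add: field_simps)
    qed
    have tr: "(\<Sum>v\<in>U'. v \<bullet> R v) = (\<Sum>u\<in>U. 1 / (1 + s * \<mu> u))"
    proof -
      have "(\<Sum>v\<in>U'. v \<bullet> R v) = (\<Sum>v\<in>U'. \<Sum>u\<in>U. (u \<bullet> v)\<^sup>2 / (1 + s * \<mu> u))"
      proof (intro sum.cong refl)
        fix v assume "v \<in> U'"
        then have "v \<in> span U" using span span_base by metis
        then show "v \<bullet> R v = (\<Sum>u\<in>U. (u \<bullet> v)\<^sup>2 / (1 + s * \<mu> u))"
          by (subst orthonormal_parseval[OF U]) (auto simp: uR power2_eq_square)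
      qed
      also have "\<dots> = (\<Sum>u\<in>U. (\<Sum>v\<in>U'. (u \<bullet> v)\<^sup>2) / (1 + s * \<mu> u))"
        by (subst sum.swap) (simp add: sum_divide_distrib)
      finally show ?thesis by (simp add: uv)
    qed
    have nR: "(\<Sum>v\<in>U'. (R f \<bullet> v)\<^sup>2) = (\<Sum>u\<in>U. (u \<bullet> f)\<^sup>2 / (1 + s * \<mu> u)\<^sup>2)"
    proof -
      have "(\<Sum>v\<in>U'. (R f \<bullet> v)\<^sup>2) = R f \<bullet> R f"
        using orthonormal_parseval[OF U', of "R f" "R f"] Rspan span
        by (simp add: power2_eq_square inner_commute)
      also have "\<dots> = (\<Sum>u\<in>U. (u \<bullet> f)\<^sup>2 / (1 + s * \<mu> u)\<^sup>2)"
        by (subst orthonormal_parseval[OF U Rspan]) (simp add: uR power2_eq_square)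
      finally show ?thesis .
    qed
    \<comment> \<open>Reduces the trace of T (id + s T)^-1 to that of the resolvent; the constant
      terms cancel by \<open>card\<close>.\<close>
    have frac: "m / (1 + s * m) = (1 - 1 / (1 + s * m)) / s" if "1 + s * m > 0" for m
      using that s by (simp add: divide_simps)
    have "(\<Sum>v\<in>U'. \<mu>' v / (1 + s * \<mu>' v)) = (real (card U') - (\<Sum>v\<in>U'. 1 / (1 + s * \<mu>' v))) / s"
      using pos' s by (simp add: frac sum_divide_distrib[symmetric] sum_subtractf)
    moreover have "(\<Sum>u\<in>U. \<mu> u / (1 + s * \<mu> u)) = (real (card U) - (\<Sum>u\<in>U. 1 / (1 + s * \<mu> u))) / s"
      using pos s by (simp add: frac sum_divide_distrib[symmetric] sum_subtractf)
    moreover have "(\<Sum>v\<in>U'. 1 / (1 + s * \<mu>' v))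
        = (\<Sum>u\<in>U. 1 / (1 + s * \<mu> u)) - s * (\<Sum>u\<in>U. (u \<bullet> f)\<^sup>2 / (1 + s * \<mu> u)\<^sup>2) / g s"
      by (simp add: step sum_subtractf tr nR[symmetric] sum_distrib_left sum_divide_distrib)
    ultimately show ?thesis using card s by (simp add: add_divide_distrib diff_divide_distrib)
  qed
  have dg: "(g has_real_derivative (\<Sum>u\<in>U. (u \<bullet> f)\<^sup>2 / (1 + s * \<mu> u)\<^sup>2)) (at s)" if "s > 0" for s
  proof -
    have "(g has_real_derivative
        s * (\<Sum>u\<in>U. - ((u \<bullet> f)\<^sup>2 * \<mu> u) / (1 + s * \<mu> u)\<^sup>2) + (\<Sum>u\<in>U. (u \<bullet> f)\<^sup>2 / (1 + s * \<mu> u))) (at s)"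
      unfolding g_def using pos[of _ s] that
      by (auto intro!: derivative_eq_intros simp: power2_eq_square less_imp_neq[symmetric])
    moreover have "s * (\<Sum>u\<in>U. - ((u \<bullet> f)\<^sup>2 * \<mu> u) / (1 + s * \<mu> u)\<^sup>2) + (\<Sum>u\<in>U. (u \<bullet> f)\<^sup>2 / (1 + s * \<mu> u))
        = (\<Sum>u\<in>U. (u \<bullet> f)\<^sup>2 / (1 + s * \<mu> u)\<^sup>2)"
      unfolding sum_distrib_left sum.distrib[symmetric]
    proof (intro sum.cong refl)
      fix u assume "u \<in> U"
      then have "1 + s * \<mu> u \<noteq> 0" using pos[of u s] that by simp
      then show "s * (- ((u \<bullet> f)\<^sup>2 * \<mu> u) / (1 + s * \<mu> u)\<^sup>2) + (u \<bullet> f)\<^sup>2 / (1 + s * \<mu> u)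
          = (u \<bullet> f)\<^sup>2 / (1 + s * \<mu> u)\<^sup>2"
        by (simp add: divide_simps power2_eq_square) (simp add: algebra_simps)
    qed
    ultimately show ?thesis by simp
  qed
  \<comment> \<open>The derivative is taken only on the open interval, since the trace identity
    divides by \<open>s\<close>; continuity reaches the endpoint 0.\<close>
  have "L \<tau> = L 0"
  proof (rule DERIV_isconst_end[OF \<tau>])
    have "continuous_on {0..\<tau>} g"
      unfolding g_def using pos by (intro continuous_intros) (auto simp: less_imp_neq[symmetric])
    then show "continuous_on {0..\<tau>} L"
      unfolding L_def using pos pos' gpos
      by (intro continuous_intros) (auto simp: less_imp_neq[symmetric])
    fix s assume s: "0 < s" "s < \<tau>"
    have "(L has_real_derivative (\<Sum>v\<in>U'. \<mu>' v / (1 + s * \<mu>' v)) - (\<Sum>u\<in>U. \<mu> u / (1 + s * \<mu> u))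
        - (\<Sum>u\<in>U. (u \<bullet> f)\<^sup>2 / (1 + s * \<mu> u)\<^sup>2) / g s) (at s)"
      unfolding L_def using pos[of _ s] pos'[of _ s] gpos[of s] s dg[OF s(1)]
      by (auto intro!: derivative_eq_intros simp: less_imp_neq[symmetric] divide_inverse mult.commute)
    then show "(L has_real_derivative 0) (at s)" using trace[OF s(1)] by simp
  qed
  also have "L 0 = 0" by (simp add: L_def g_def)
  finally have "(\<Sum>v\<in>U'. ln (1 + \<tau> * \<mu>' v)) = (\<Sum>u\<in>U. ln (1 + \<tau> * \<mu> u)) + ln (g \<tau>)"
    by (simp add: L_def)
  then have "exp (\<Sum>v\<in>U'. ln (1 + \<tau> * \<mu>' v)) = exp (\<Sum>u\<in>U. ln (1 + \<tau> * \<mu> u)) * exp (ln (g \<tau>))"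
    by (simp add: exp_add)
  moreover have "exp (\<Sum>v\<in>U'. ln (1 + \<tau> * \<mu>' v)) = (\<Prod>v\<in>U'. 1 + \<tau> * \<mu>' v)"
    unfolding exp_sum[OF U'(1)] using pos'[of _ \<tau>] \<tau> by (intro prod.cong) auto
  moreover have "exp (\<Sum>u\<in>U. ln (1 + \<tau> * \<mu> u)) = (\<Prod>u\<in>U. 1 + \<tau> * \<mu> u)"
    unfolding exp_sum[OF U(1)] using pos[of _ \<tau>] \<tau> by (intro prod.cong) auto
  ultimately show ?thesis using gpos[of \<tau>] \<tau> by (simp add: g_def)
qed

text \<open>The definite description is meaningful only once existence and uniqueness of the root
  are known. Existence comes from the explicit operator \<open>C\<close>; uniqueness holds because
  \<open>A\<close> is diagonal on \<open>U\<close> and equal to \<rho> on its orthogonal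
  complement.\<close>

lemma inv_sqrt_op_properties:
  fixes T :: "'h::real_inner \<Rightarrow> 'h"
  assumes U: "finite U" "orthonormal U" and T: "\<And>h. T h = (\<Sum>u\<in>U. (\<mu> u * (u \<bullet> h)) *\<^sub>R u)"
    and \<mu>: "\<And>u. u \<in> U \<Longrightarrow> 0 \<le> \<mu> u" and \<rho>: "\<rho> > 0"
  defines "A \<equiv> \<lambda>h. \<rho> *\<^sub>R h + T h"
  defines "B \<equiv> inv_sqrt_op A"
  shows "bounded_linear B \<and> (\<forall>x y. B x \<bullet> y = x \<bullet> B y) \<and> (\<forall>x. 0 \<le> B x \<bullet> x)
    \<and> (\<forall>x. B (B (A x)) = x \<and> A (B (B x)) = x)"
proof -
  define Pr where "Pr B \<longleftrightarrow> bounded_linear B \<and> (\<forall>x y. B x \<bullet> y = x \<bullet> B y) \<and> (\<forall>x. 0 \<le> B x \<bullet> x)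
    \<and> (\<forall>x. B (B (A x)) = x \<and> A (B (B x)) = x)" for B :: "'h \<Rightarrow> 'h"
  define P where "P h = (\<Sum>u\<in>U. (u \<bullet> h) *\<^sub>R u)" for h
  define c where "c m = 1 / sqrt (\<rho> + m)" for m
  have cpos: "c (\<mu> u) > 0" if "u \<in> U" for u using \<mu>[OF that] \<rho> by (simp add: c_def)
  have c2: "c (\<mu> u) * c (\<mu> u) * (\<rho> + \<mu> u) = 1" if "u \<in> U" for u
    using \<mu>[OF that] \<rho> by (simp add: c_def)
  have c0: "c 0 > 0" "c 0 * c 0 * \<rho> = 1" using \<rho> by (simp_all add: c_def)
  \<comment> \<open>Each eigenvector is scaled by the inverse root of its eigenvalue under
    \<open>A\<close>; on the complement of \<open>U\<close>, where \<open>T\<close> vanishes, that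
    eigenvalue is \<rho>, hence \<open>c 0\<close>.\<close>
  define C where "C h = c 0 *\<^sub>R (h - P h) + (\<Sum>u\<in>U. (c (\<mu> u) * (u \<bullet> h)) *\<^sub>R u)" for h
  have uP: "u \<bullet> P h = u \<bullet> h" if "u \<in> U" for u h
    unfolding P_def by (rule orthonormal_inner_sum[OF U that])
  have uC: "u \<bullet> C h = c (\<mu> u) * (u \<bullet> h)" if "u \<in> U" for u h
    by (simp add: C_def inner_add_right inner_diff_right uP that orthonormal_inner_sum[OF U that])
  have uT: "u \<bullet> T h = \<mu> u * (u \<bullet> h)" if "u \<in> U" for u h
    unfolding T by (rule orthonormal_inner_sum[OF U that])
  \<comment> \<open>Operator identities are checked separately on the coordinates along
    \<open>U\<close> and on the residual.\<close>
  have eqI: "x = y" if "\<And>u. u \<in> U \<Longrightarrow> u \<bullet> x = u \<bullet> y" "x - P x = y - P y" for x y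
  proof -
    have "P x = P y" unfolding P_def by (intro sum.cong) (auto simp: that(1))
    then show ?thesis using that(2) by simp
  qed
  have res_sum: "(\<Sum>u\<in>U. d u *\<^sub>R u) - P (\<Sum>u\<in>U. d u *\<^sub>R u) = 0" for d
    unfolding P_def using orthonormal_expansion[OF U orthonormal_sum_in_span] by simp
  have P_lin: "P (x + y) = P x + P y" "P (a *\<^sub>R x) = a *\<^sub>R P x" for x y a
    by (simp_all add: P_def inner_add_right scaleR_add_left sum.distrib scaleR_sum_right)
  have P_idem: "P (P x) = P x" for x
    unfolding P_def by (intro sum.cong refl) (simp add: uP[unfolded P_def])
  have P_diff: "P (x - y) = P x - P y" for x y
    by (simp add: P_def inner_diff_right scaleR_diff_left sum_subtractf)
  have resC: "C h - P (C h) = c 0 *\<^sub>R (h - P h)" for h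
    using res_sum[of "\<lambda>u. c (\<mu> u) * (u \<bullet> h)"] by (simp add: C_def P_lin P_diff P_idem)
  have resA: "A h - P (A h) = \<rho> *\<^sub>R (h - P h)" for h
    using res_sum[of "\<lambda>u. \<mu> u * (u \<bullet> h)"] unfolding A_def T
    by (simp add: P_lin scaleR_diff_right)
  have uA: "u \<bullet> A h = (\<rho> + \<mu> u) * (u \<bullet> h)" if "u \<in> U" for u h
    by (simp add: A_def inner_add_right uT[OF that] distrib_right)
  have "Pr C" unfolding Pr_def
  proof (intro conjI allI)
    show "bounded_linear C"
      unfolding C_def P_def
      by (intro bounded_linear_add bounded_linear_const_scaleR bounded_linear_sub bounded_linear_ident
          bounded_linear_sum bounded_linear_scaleR_const bounded_linear_const_mult bounded_linear_inner_right)
    have form: "C x \<bullet> y = c 0 * ((x - P x) \<bullet> y) + (\<Sum>u\<in>U. c (\<mu> u) * (u \<bullet> x) * (u \<bullet> y))" for x y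
      by (simp add: C_def inner_add_left inner_sum_left)
    have Psym: "P x \<bullet> y = (\<Sum>u\<in>U. (u \<bullet> x) * (u \<bullet> y))" for x y
      by (simp add: P_def inner_sum_left)
    have rsym: "(x - P x) \<bullet> y = (y - P y) \<bullet> x" for x y
      by (simp add: inner_diff_left Psym inner_commute[of x y] mult.commute)
    show "C x \<bullet> y = x \<bullet> C y" for x y
      unfolding inner_commute[of x "C y"] form by (subst rsym) (simp add: mult_ac)
    show "0 \<le> C x \<bullet> x" for x
    proof -
      have "(x - P x) \<bullet> P x = 0"
        unfolding inner_commute[of _ "P x"] Psym by (simp add: inner_diff_right uP)
      then have "(x - P x) \<bullet> x = (x - P x) \<bullet> (x - P x)" by (simp add: inner_diff_right)
      then have "0 \<le> (x - P x) \<bullet> x" by simp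
      moreover have "0 \<le> (\<Sum>u\<in>U. c (\<mu> u) * (u \<bullet> x) * (u \<bullet> x))"
        using cpos by (intro sum_nonneg) (auto simp: mult.assoc less_imp_le)
      ultimately show ?thesis unfolding form using c0 by simp
    qed
    show "C (C (A x)) = x" for x
      by (rule eqI) (use c2 c0 in \<open>simp_all add: uC uA resC resA flip: mult.assoc\<close>)
    show "A (C (C x)) = x" for x
      by (rule eqI) (use c2 c0 in \<open>simp_all add: uC uA resC resA mult_ac\<close>)
  qed
  text \<open>A positive square root of \<open>A\<^sup>-\<^sup>1\<close> acts on each eigenvector of \<open>T\<close> as a scalar.\<close>
  moreover have "B' = C" if "Pr B'" for B'
  proof
    fix h
    have lin: "linear B'" and pos: "\<And>x. 0 \<le> B' x \<bullet> x" and inv: "\<And>x. B' (B' (A x)) = x"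
      using that by (auto simp: Pr_def bounded_linear.linear)
    have eig: "B' x = d *\<^sub>R x" if "A x = a *\<^sub>R x" "d > 0" "d * d * a = 1" for x d a
    proof -
      \<comment> \<open>Since (B' + d) (B' - d) x = 0, a nonzero \<open>y\<close> would be an
        eigenvector of \<open>B'\<close> for the negative eigenvalue -d, contradicting
        positivity.\<close>
      define y where "y = B' x - d *\<^sub>R x"
      have "a *\<^sub>R B' (B' x) = x"
        using inv[of x] that(1) by (simp add: linear_scale[OF lin])
      then have "(d * d * a) *\<^sub>R B' (B' x) = (d * d) *\<^sub>R x" by (metis scaleR_scaleR)
      then have "B' (B' x) = (d * d) *\<^sub>R x" using that(3) by simp
      then have "B' y = - d *\<^sub>R y"
        by (simp add: y_def linear_diff[OF lin] linear_scale[OF lin] scaleR_diff_right)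
      then have "0 \<le> - d * (y \<bullet> y)" using pos[of y] by simp
      then have "y \<bullet> y \<le> 0" using that(2) by (simp add: mult_le_0_iff)
      then have "y = 0" by (metis inner_eq_zero_iff inner_ge_zero order_antisym)
      then show ?thesis by (simp add: y_def)
    qed
    have "A u = (\<rho> + \<mu> u) *\<^sub>R u" if "u \<in> U" for u
    proof -
      have "T u = (\<Sum>v\<in>U. if v = u then \<mu> u *\<^sub>R u else 0)"
        unfolding T using U that by (intro sum.cong) (auto simp: orthonormal_inner)
      then show ?thesis using U that by (simp add: A_def scaleR_add_left)
    qed
    then have Bu: "B' u = c (\<mu> u) *\<^sub>R u" if "u \<in> U" for u
      using eig[of u "\<rho> + \<mu> u" "c (\<mu> u)"] cpos c2 that by simp
    have "T (h - P h) = 0" unfolding T by (intro sum.neutral) (simp add: inner_diff_right uP)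
    then have Br: "B' (h - P h) = c 0 *\<^sub>R (h - P h)"
      using eig[of "h - P h" \<rho> "c 0"] c0 by (simp add: A_def)
    have "B' h = B' (h - P h) + B' (P h)" using linear_add[OF lin, of "h - P h" "P h"] by simp
    also have "B' (P h) = (\<Sum>u\<in>U. (c (\<mu> u) * (u \<bullet> h)) *\<^sub>R u)"
      unfolding P_def linear_sum[OF lin] linear_scale[OF lin]
      by (intro sum.cong) (auto simp: Bu mult.commute)
    finally show "B' h = C h" by (simp add: C_def Br)
  qed
  ultimately have "Pr (THE B. Pr B)" by (rule theI)
  then show ?thesis unfolding B_def inv_sqrt_op_def Pr_def .
qed

subsection \<open>Sums of rank-one operators and their resolvents\<close>

definition gram_op :: "(nat \<Rightarrow> 'h::real_inner) \<Rightarrow> nat \<Rightarrow> 'h \<Rightarrow> 'h" where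
  "gram_op g t h = (\<Sum>s\<in>{1..t}. (g s \<bullet> h) *\<^sub>R g s)"

lemma gram_op_0 [simp]: "gram_op g 0 h = 0"
  by (simp add: gram_op_def)

lemma gram_op_Suc: "gram_op g (Suc t) h = gram_op g t h + (g (Suc t) \<bullet> h) *\<^sub>R g (Suc t)"
  by (simp add: gram_op_def)

lemma linear_gram_op: "linear (gram_op g t)"
  by (rule linearI)
    (simp_all add: gram_op_def inner_add_right scaleR_add_left sum.distrib scaleR_sum_right)

lemma gram_op_inner: "gram_op g t x \<bullet> y = (\<Sum>s\<in>{1..t}. (g s \<bullet> x) * (g s \<bullet> y))"
  by (simp add: gram_op_def inner_sum_left)

lemma gram_op_sym: "gram_op g t x \<bullet> y = x \<bullet> gram_op g t y"
  unfolding inner_commute[of x] gram_op_inner by (simp add: mult.commute)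

lemma gram_op_nonneg: "0 \<le> gram_op g t x \<bullet> x"
  unfolding gram_op_inner by (intro sum_nonneg) simp

text \<open>The basis may span more than the range at time \<open>t\<close>. With
  \<open>n = Suc t\<close>, consecutive operators are diagonalised over the same space.\<close>

lemma gram_op_spectral:
  fixes g :: "nat \<Rightarrow> 'h::real_inner"
  assumes "t \<le> n"
  obtains U \<mu> where "finite U" "orthonormal U" "span U = span (g ` {1..n})"
    "\<And>h. gram_op g t h = (\<Sum>u\<in>U. (\<mu> u * (u \<bullet> h)) *\<^sub>R u)"
    "\<And>u. u \<in> U \<Longrightarrow> gram_op g t u = \<mu> u *\<^sub>R u"
    "\<And>u. u \<in> U \<Longrightarrow> 0 \<le> \<mu> u"
proof -
  have range: "gram_op g t h \<in> span (g ` {1..n})" for h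
    unfolding gram_op_def using assms by (intro span_sum span_scale span_base) auto
  obtain U where U: "finite U" "orthonormal U" "span U = span (g ` {1..n})"
    "\<And>u. u \<in> U \<Longrightarrow> gram_op g t u = (gram_op g t u \<bullet> u) *\<^sub>R u"
    using spectral_theorem_finite_span[OF linear_gram_op gram_op_sym _ range] by blast
  show thesis
  proof (rule that[OF U(1-3) _ U(4)])
    show "gram_op g t h = (\<Sum>u\<in>U. ((gram_op g t u \<bullet> u) * (u \<bullet> h)) *\<^sub>R u)" for h
      using spectral_representation[OF gram_op_sym U(1,2) _ U(4)] range U(3) by blast
  qed (auto simp: gram_op_nonneg)
qed

section \<open>The Sherman-Morrison recursion, and the determinant and norm in terms of it\<close>

fun resolvent :: "real \<Rightarrow> (nat \<Rightarrow> 'h::real_inner) \<Rightarrow> nat \<Rightarrow> 'h \<Rightarrow> 'h" where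
  "resolvent \<rho> g 0 h = (1 / \<rho>) *\<^sub>R h"
| "resolvent \<rho> g (Suc t) h = resolvent \<rho> g t h
     - ((g (Suc t) \<bullet> resolvent \<rho> g t h) / (1 + g (Suc t) \<bullet> resolvent \<rho> g t (g (Suc t))))
       *\<^sub>R resolvent \<rho> g t (g (Suc t))"

lemma linear_resolvent: "linear (resolvent \<rho> g t)"
proof (induction t)
  case 0
  show ?case by (rule linearI) (simp_all add: scaleR_add_right)
next
  case (Suc t)
  show ?case
    by (rule linearI) (simp_all add: linear_add[OF Suc] linear_scale[OF Suc] inner_add_right
        add_divide_distrib scaleR_add_left scaleR_diff_right)
qed

lemma resolvent_sym: "resolvent \<rho> g t x \<bullet> y = x \<bullet> resolvent \<rho> g t y"
proof (induction t arbitrary: x y)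
  case (Suc t)
  show ?case
    by (simp add: inner_diff_left inner_diff_right Suc[of x y] Suc[of "g (Suc t)" y, symmetric]
        Suc[of "g (Suc t)" x, symmetric] inner_commute[of x "resolvent \<rho> g t (g (Suc t))"])
qed simp

text \<open>Conditional on the inverse property because the induction for that property needs, at
  each step, a nonzero denominator \<open>1 + q\<close>, hence nonnegativity one step
  earlier.\<close>

lemma resolvent_nonneg_if_inverse:
  assumes "\<rho> > 0" "\<And>h. \<rho> *\<^sub>R resolvent \<rho> g t h + gram_op g t (resolvent \<rho> g t h) = h"
  shows "0 \<le> h \<bullet> resolvent \<rho> g t h"
proof -
  let ?R = "resolvent \<rho> g t h"
  have "h \<bullet> ?R = (\<rho> *\<^sub>R ?R + gram_op g t ?R) \<bullet> ?R" by (simp only: assms(2))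
  also have "\<dots> = \<rho> * (?R \<bullet> ?R) + gram_op g t ?R \<bullet> ?R" by (simp add: inner_add_left)
  finally show ?thesis using assms(1) gram_op_nonneg[of g t ?R] by simp
qed

lemma resolvent_right_inverse:
  assumes "\<rho> > 0"
  shows "\<rho> *\<^sub>R resolvent \<rho> g t h + gram_op g t (resolvent \<rho> g t h) = h"
proof (induction t arbitrary: h)
  case 0
  then show ?case using assms by simp
next
  case (Suc t)
  let ?R = "resolvent \<rho> g t" and ?f = "g (Suc t)"
  define q where "q = ?f \<bullet> ?R ?f"
  define c where "c = (?f \<bullet> ?R h) / (1 + q)"
  have q: "q \<ge> 0" using resolvent_nonneg_if_inverse[OF assms Suc] by (simp add: q_def)
  have R': "resolvent \<rho> g (Suc t) h = ?R h - c *\<^sub>R ?R ?f" by (simp add: c_def q_def)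
  \<comment> \<open>\<open>c\<close> is chosen to make this hold: the rank-one term of the new
    operator then contributes \<open>c\<close> times the new vector, which cancels what the
    correction takes away.\<close>
  have "?f \<bullet> (?R h - c *\<^sub>R ?R ?f) = c"
    using q by (simp add: inner_diff_right q_def[symmetric] c_def field_simps)
  then have "\<rho> *\<^sub>R (?R h - c *\<^sub>R ?R ?f) + gram_op g (Suc t) (?R h - c *\<^sub>R ?R ?f)
      = (\<rho> *\<^sub>R ?R h + gram_op g t (?R h)) - c *\<^sub>R (\<rho> *\<^sub>R ?R ?f + gram_op g t (?R ?f)) + c *\<^sub>R ?f"
    by (simp add: gram_op_Suc linear_diff[OF linear_gram_op] linear_scale[OF linear_gram_op]
        scaleR_diff_right scaleR_add_right algebra_simps)
  then show ?case unfolding R' Suc by simp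
qed

lemma resolvent_nonneg: "\<rho> > 0 \<Longrightarrow> 0 \<le> h \<bullet> resolvent \<rho> g t h"
  by (rule resolvent_nonneg_if_inverse[OF _ resolvent_right_inverse])

text \<open>With y = x + e f, the new form is <y, R_t y> - <f, R_t y>^2 / (1 + q), and <f, R_t y> =
  a + e q. For x = S_t / sigma this is the growth of the exponent in one step.\<close>

lemma resolvent_quadratic_update:
  fixes g :: "nat \<Rightarrow> 'h::real_inner" and t :: nat and x :: 'h
  assumes "\<rho> > 0"
  defines "q \<equiv> g (Suc t) \<bullet> resolvent \<rho> g t (g (Suc t))"
    and "a \<equiv> g (Suc t) \<bullet> resolvent \<rho> g t x"
  shows "(x + e *\<^sub>R g (Suc t)) \<bullet> resolvent \<rho> g (Suc t) (x + e *\<^sub>R g (Suc t))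
       = x \<bullet> resolvent \<rho> g t x + (2 * e * a + e\<^sup>2 * q - a\<^sup>2) / (1 + q)"
proof -
  have q: "1 + q > 0" using resolvent_nonneg[OF assms(1), of "g (Suc t)" g t] by (simp add: q_def)
  have sym: "x \<bullet> resolvent \<rho> g t (g (Suc t)) = a"
    unfolding a_def using resolvent_sym[of \<rho> g t x "g (Suc t)"] by (simp add: inner_commute)
  have "(x + e *\<^sub>R g (Suc t)) \<bullet> resolvent \<rho> g (Suc t) (x + e *\<^sub>R g (Suc t))
      = x \<bullet> resolvent \<rho> g t x + 2 * e * a + e\<^sup>2 * q - (a + e * q) * (a + e * q) / (1 + q)"
    by (simp add: linear_add[OF linear_resolvent] linear_scale[OF linear_resolvent] inner_add_left
        inner_add_right inner_diff_right sym a_def[symmetric] q_def[symmetric] power2_eq_square algebra_simps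
        add_divide_distrib)
  also have "\<dots> = x \<bullet> resolvent \<rho> g t x + (2 * e * a + e\<^sup>2 * q - a\<^sup>2) / (1 + q)"
    using q by (simp add: field_simps power2_eq_square)
  finally show ?thesis .
qed

text \<open>Links the recursive resolvent to the sum over eigenvalues that appears in
  \<open>prod_eigenvalues_rank_one_update\<close>.\<close>

lemma resolvent_spectral:
  fixes g :: "nat \<Rightarrow> 'h::real_inner"
  assumes \<rho>: "\<rho> > 0" and U: "finite U" "orthonormal U"
    and T: "\<And>h. gram_op g t h = (\<Sum>u\<in>U. (\<mu> u * (u \<bullet> h)) *\<^sub>R u)"
    and \<mu>: "\<And>u. u \<in> U \<Longrightarrow> 0 \<le> \<mu> u" and f: "f \<in> span U"
  shows "f \<bullet> resolvent \<rho> g t f = (\<Sum>u\<in>U. (u \<bullet> f)\<^sup>2 / (\<rho> + \<mu> u))"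
proof -
  have "u \<bullet> resolvent \<rho> g t f = (u \<bullet> f) / (\<rho> + \<mu> u)" if u: "u \<in> U" for u
  proof -
    have "u \<bullet> f = u \<bullet> (\<rho> *\<^sub>R resolvent \<rho> g t f + gram_op g t (resolvent \<rho> g t f))"
      by (simp add: resolvent_right_inverse[OF \<rho>])
    also have "\<dots> = (\<rho> + \<mu> u) * (u \<bullet> resolvent \<rho> g t f)"
      unfolding T by (simp add: inner_add_right orthonormal_inner_sum[OF U u] distrib_right)
    finally show ?thesis using \<mu>[OF u] \<rho> by simp
  qed
  then show ?thesis
    by (subst orthonormal_parseval[OF U f]) (simp add: power2_eq_square)
qed

text \<open>The rank-one update at parameter 1 / \<rho>, with eigenbases of both operators taken in
  the span that already contains the new vector.\<close>

lemma fredholm_det_gram_op_Suc: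
  fixes g :: "nat \<Rightarrow> 'h::real_inner"
  assumes \<rho>: "\<rho> > 0"
  shows "fredholm_det_id_plus (\<lambda>h. (1 / \<rho>) *\<^sub>R gram_op g (Suc t) h)
       = fredholm_det_id_plus (\<lambda>h. (1 / \<rho>) *\<^sub>R gram_op g t h)
         * (1 + g (Suc t) \<bullet> resolvent \<rho> g t (g (Suc t)))"
proof -
  obtain U \<mu> where U: "finite U" "orthonormal U" and spU: "span U = span (g ` {1..Suc t})"
    and T: "\<And>h. gram_op g t h = (\<Sum>u\<in>U. (\<mu> u * (u \<bullet> h)) *\<^sub>R u)"
    and \<mu>: "\<And>u. u \<in> U \<Longrightarrow> 0 \<le> \<mu> u"
    by (rule gram_op_spectral[of t "Suc t" g]) auto
  obtain U' \<mu>' where U': "finite U'" "orthonormal U'" and spU': "span U' = span (g ` {1..Suc t})"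
    and T': "\<And>h. gram_op g (Suc t) h = (\<Sum>u\<in>U'. (\<mu>' u * (u \<bullet> h)) *\<^sub>R u)"
    and eig': "\<And>u. u \<in> U' \<Longrightarrow> gram_op g (Suc t) u = \<mu>' u *\<^sub>R u"
    and \<mu>': "\<And>u. u \<in> U' \<Longrightarrow> 0 \<le> \<mu>' u"
    by (rule gram_op_spectral[of "Suc t" "Suc t" g]) auto
  have f: "g (Suc t) \<in> span U" unfolding spU by (intro span_base) auto
  have "fredholm_det_id_plus (\<lambda>h. (1 / \<rho>) *\<^sub>R gram_op g (Suc t) h) = (\<Prod>v\<in>U'. 1 + 1 / \<rho> * \<mu>' v)"
    by (rule fredholm_det_eigenbasis[OF U']) (simp add: T' scaleR_sum_right)
  also have "\<dots> = (\<Prod>u\<in>U. 1 + 1 / \<rho> * \<mu> u)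
      * (1 + 1 / \<rho> * (\<Sum>u\<in>U. (u \<bullet> g (Suc t))\<^sup>2 / (1 + 1 / \<rho> * \<mu> u)))"
    using eig' \<rho> spU spU'
    by (intro prod_eigenvalues_rank_one_update[OF U U' _ f T _ \<mu> \<mu>']) (auto simp: gram_op_Suc)
  also have "(\<Prod>u\<in>U. 1 + 1 / \<rho> * \<mu> u) = fredholm_det_id_plus (\<lambda>h. (1 / \<rho>) *\<^sub>R gram_op g t h)"
    by (rule fredholm_det_eigenbasis[OF U, symmetric]) (simp add: T scaleR_sum_right)
  also have "1 / \<rho> * (\<Sum>u\<in>U. (u \<bullet> g (Suc t))\<^sup>2 / (1 + 1 / \<rho> * \<mu> u))
      = g (Suc t) \<bullet> resolvent \<rho> g t (g (Suc t))"
    unfolding sum_distrib_left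
  proof (subst resolvent_spectral[OF \<rho> U T \<mu> f], assumption, intro sum.cong refl)
    fix u assume "u \<in> U"
    show "1 / \<rho> * ((u \<bullet> g (Suc t))\<^sup>2 / (1 + 1 / \<rho> * \<mu> u)) = (u \<bullet> g (Suc t))\<^sup>2 / (\<rho> + \<mu> u)"
      using \<mu>[OF \<open>u \<in> U\<close>] \<rho> by (simp add: field_simps)
  qed
  finally show ?thesis .
qed

text \<open>Turns a quantity defined by eigenvalues into a product of explicit factors at least 1,
  from which measurability and positivity can be read off.\<close>

lemma fredholm_det_gram_op:
  fixes g :: "nat \<Rightarrow> 'h::real_inner"
  assumes "\<rho> > 0"
  shows "fredholm_det_id_plus (\<lambda>h. (1 / \<rho>) *\<^sub>R gram_op g t h)
       = (\<Prod>s<t. 1 + g (Suc s) \<bullet> resolvent \<rho> g s (g (Suc s)))"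
proof (induction t)
  case 0
  show ?case using fredholm_det_eigenbasis[of "{}" "\<lambda>h::'h. 0"] by (simp add: orthonormal_def)
next
  case (Suc t)
  then show ?case using fredholm_det_gram_op_Suc[OF assms, of g t] by simp
qed

lemma norm_inv_sqrt_op_gram_op:
  fixes g :: "nat \<Rightarrow> 'h::real_inner"
  assumes \<rho>: "\<rho> > 0"
  shows "(norm (inv_sqrt_op (\<lambda>h. \<rho> *\<^sub>R h + gram_op g t h) x))\<^sup>2 = x \<bullet> resolvent \<rho> g t x"
proof -
  obtain U \<mu> where U: "finite U" "orthonormal U"
    and T: "\<And>h. gram_op g t h = (\<Sum>u\<in>U. (\<mu> u * (u \<bullet> h)) *\<^sub>R u)"
    and \<mu>: "\<And>u. u \<in> U \<Longrightarrow> 0 \<le> \<mu> u"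
    by (rule gram_op_spectral[of t t g]) auto
  let ?B = "inv_sqrt_op (\<lambda>h. \<rho> *\<^sub>R h + gram_op g t h)"
  have B: "?B x \<bullet> y = x \<bullet> ?B y" "?B (?B (\<rho> *\<^sub>R x + gram_op g t x)) = x" for x y
    using inv_sqrt_op_properties[OF U T \<mu> \<rho>] by blast+
  \<comment> \<open>A left inverse and a right inverse of the same operator coincide.\<close>
  have "?B (?B x) = resolvent \<rho> g t x"
    using B(2)[of "resolvent \<rho> g t x"] by (simp add: resolvent_right_inverse[OF \<rho>])
  then show ?thesis unfolding power2_norm_eq_inner B(1) by simp
qed

subsection \<open>Sub-Gaussian noise and supermartingales\<close>

text \<open>Reduces the inner product to norms by polarisation. The distance of two measurable maps
  is below a bound exactly if the detour through some point of the countable dense set is, which is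
  a countable union of measurable events.\<close>

lemma borel_measurable_inner_separable:
  fixes f g :: "'a \<Rightarrow> 'h::real_inner"
  assumes sep: "\<exists>D::'h set. countable D \<and> closure D = UNIV"
    and f: "f \<in> borel_measurable M" and g: "g \<in> borel_measurable M"
  shows "(\<lambda>x. f x \<bullet> g x) \<in> borel_measurable M"
proof -
  obtain D :: "'h set" where D: "countable D" "closure D = UNIV" using sep by blast
  have nf: "(\<lambda>x. norm (f x - d)) \<in> borel_measurable M" for d
    by (rule measurable_compose[OF f borel_measurable_continuous_onI]) (intro continuous_intros)
  have ng: "(\<lambda>x. norm (g x - d)) \<in> borel_measurable M" for d
    by (rule measurable_compose[OF g borel_measurable_continuous_onI]) (intro continuous_intros)
  have "(\<lambda>x. norm (f x - g x)) \<in> borel_measurable M"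
    unfolding borel_measurable_iff_less
  proof
    fix a :: real
    have "{w \<in> space M. norm (f w - g w) < a}
        = (\<Union>d\<in>D. {w \<in> space M. norm (f w - d) + norm (g w - d) < a})" (is "?L = ?R")
    proof (intro equalityI subsetI)
      fix w assume w: "w \<in> ?L"
      \<comment> \<open>A dense point within half the slack of \<open>g w\<close> costs less than
        the full slack, as its distance enters the detour twice.\<close>
      define r where "r = (a - norm (f w - g w)) / 2"
      have "r > 0" using w by (simp add: r_def)
      moreover have "g w \<in> closure D" using D by simp
      ultimately obtain d where d: "d \<in> D" "dist d (g w) < r"
        unfolding closure_approachable by blast
      have "norm (f w - d) \<le> norm (f w - g w) + norm (g w - d)"
        using norm_triangle_ineq[of "f w - g w" "g w - d"] by simp
      moreover have "norm (g w - d) < r" using d by (simp add: dist_norm norm_minus_commute)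
      ultimately have "norm (f w - d) + norm (g w - d) < a" by (simp add: r_def)
      then show "w \<in> ?R" using d w by auto
    next
      fix w assume "w \<in> ?R"
      then obtain d where "w \<in> space M" "norm (f w - d) + norm (g w - d) < a" by auto
      moreover have "norm (f w - g w) \<le> norm (f w - d) + norm (g w - d)"
        using norm_triangle_ineq4[of "f w - d" "g w - d"] by simp
      ultimately show "w \<in> ?L" by simp
    qed
    also have "\<dots> \<in> sets M"
    proof (rule sets.countable_UN''[OF D(1)])
      fix d assume "d \<in> D"
      show "{w \<in> space M. norm (f w - d) + norm (g w - d) < a} \<in> sets M"
        using nf[of d] ng[of d] by measurable
    qed
    finally show "{w \<in> space M. norm (f w - g w) < a} \<in> sets M" .
  qed
  then show ?thesis
    unfolding dot_norm_neg using nf[of 0] ng[of 0] by simp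
qed

text \<open>The conditional bound integrated against a known weight. The weight will carry the
  events on which a random exponent takes a fixed value.\<close>

lemma nn_integral_subgaussian_exp_const_le:
  fixes e h :: "'a \<Rightarrow> real"
  assumes "prob_space M" "subalgebra M G" and sub: "cond_subgaussian M G \<sigma> e"
    and [measurable]: "e \<in> borel_measurable M" and h [measurable]: "h \<in> borel_measurable G"
  shows "(\<integral>\<^sup>+x. ennreal (h x) * ennreal (exp (l * e x - l\<^sup>2 * \<sigma>\<^sup>2 / 2)) \<partial>M) \<le> (\<integral>\<^sup>+x. ennreal (h x) \<partial>M)"
proof -
  interpret prob_space M by fact
  interpret finite_measure_subalgebra M G by unfold_locales fact
  let ?c = "l\<^sup>2 * \<sigma>\<^sup>2 / 2"
  have hM [measurable]: "h \<in> borel_measurable M" using measurable_from_subalg[OF subalg h] .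
  have "(\<integral>\<^sup>+x. ennreal (h x) * ennreal (exp (l * e x - ?c)) \<partial>M)
      = (\<integral>\<^sup>+x. ennreal (exp (- ?c)) * (ennreal (h x) * ennreal (exp (l * e x))) \<partial>M)"
  proof (intro nn_integral_cong)
    fix x
    have "exp (l * e x - ?c) = exp (- ?c) * exp (l * e x)" by (simp flip: exp_add)
    then show "ennreal (h x) * ennreal (exp (l * e x - ?c))
        = ennreal (exp (- ?c)) * (ennreal (h x) * ennreal (exp (l * e x)))"
      by (simp only: ennreal_mult'[OF exp_ge_zero] mult.left_commute)
  qed
  also have "\<dots> = ennreal (exp (- ?c)) * (\<integral>\<^sup>+x. ennreal (h x) * ennreal (exp (l * e x)) \<partial>M)"
    by (intro nn_integral_cmult) measurable
  also have "(\<integral>\<^sup>+x. ennreal (h x) * ennreal (exp (l * e x)) \<partial>M)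
      = (\<integral>\<^sup>+x. ennreal (h x) * nn_cond_exp M G (\<lambda>y. ennreal (exp (l * e y))) x \<partial>M)"
    by (intro nn_cond_exp_intg[symmetric]) measurable
  also have "\<dots> \<le> (\<integral>\<^sup>+x. ennreal (h x) * ennreal (exp ?c) \<partial>M)"
  proof (intro nn_integral_mono_AE)
    show "AE x in M. ennreal (h x) * nn_cond_exp M G (\<lambda>y. ennreal (exp (l * e y))) x
        \<le> ennreal (h x) * ennreal (exp ?c)"
      using sub[unfolded cond_subgaussian_def, rule_format, of l] by eventually_elim (rule mult_left_mono, auto)
  qed
  also have "\<dots> = (\<integral>\<^sup>+x. ennreal (h x) \<partial>M) * ennreal (exp ?c)"
    by (intro nn_integral_multc) measurable
  finally have "(\<integral>\<^sup>+x. ennreal (h x) * ennreal (exp (l * e x - ?c)) \<partial>M)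
      \<le> ennreal (exp (- ?c)) * ((\<integral>\<^sup>+x. ennreal (h x) \<partial>M) * ennreal (exp ?c))"
    by (simp add: mult_left_mono)
  also have "\<dots> = (\<integral>\<^sup>+x. ennreal (h x) \<partial>M) * ennreal (exp (- ?c) * exp ?c)"
    by (simp add: ennreal_mult mult_ac)
  also have "\<dots> = (\<integral>\<^sup>+x. ennreal (h x) \<partial>M)" by (simp add: exp_minus)
  finally show ?thesis .
qed

text \<open>The null set of the sub-Gaussian bound depends on the exponent, so a random exponent
  cannot simply be inserted. A simple \<open>G\<close>-measurable exponent is split over its
  finitely many values, with indicators absorbed into the weight; the general case follows by
  approximation and Fatou's lemma, which suffices for an upper bound.\<close>

lemma nn_integral_subgaussian_exp_le:
  fixes e h L :: "'a \<Rightarrow> real"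
  assumes M: "prob_space M" "subalgebra M G" and sub: "cond_subgaussian M G \<sigma> e"
    and e [measurable]: "e \<in> borel_measurable M"
    and h [measurable]: "h \<in> borel_measurable G" and h0: "\<And>x. 0 \<le> h x"
    and L: "L \<in> borel_measurable G"
  shows "(\<integral>\<^sup>+x. ennreal (h x * exp (L x * e x - (L x)\<^sup>2 * \<sigma>\<^sup>2 / 2)) \<partial>M) \<le> (\<integral>\<^sup>+x. ennreal (h x) \<partial>M)"
proof -
  have hM [measurable]: "h \<in> borel_measurable M" using measurable_from_subalg[OF M(2) h] .
  have sp: "space G = space M" using M(2) by (simp add: subalgebra_def)
  define \<phi> where "\<phi> l x = exp (l * e x - l\<^sup>2 * \<sigma>\<^sup>2 / 2)" for l x
  have simple: "(\<integral>\<^sup>+x. ennreal (h x * \<phi> (s x) x) \<partial>M) \<le> (\<integral>\<^sup>+x. ennreal (h x) \<partial>M)"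
    if s: "simple_function G s" for s
  proof -
    let ?I = "s ` space G"
    have fin: "finite ?I" using s by (simp add: simple_function_def)
    have [measurable]: "s \<in> borel_measurable G" using borel_measurable_simple_function[OF s] .
    have [measurable]: "s \<in> borel_measurable M"
      using measurable_from_subalg[OF M(2) borel_measurable_simple_function[OF s]] .
    have split: "u x (s x) = (\<Sum>l\<in>?I. u x l * indicator {l} (s x))" if "x \<in> space M"
      for u :: "'a \<Rightarrow> real \<Rightarrow> real" and x
    proof -
      have "(\<Sum>l\<in>?I. u x l * indicator {l} (s x)) = (\<Sum>l\<in>?I. if s x = l then u x l else 0)"
        by (intro sum.cong) auto
      also have "\<dots> = u x (s x)" using that fin by (subst sum.delta') (auto simp: sp)
      finally show ?thesis ..
    qed
    have "(\<integral>\<^sup>+x. ennreal (h x * \<phi> (s x) x) \<partial>M)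
        = (\<integral>\<^sup>+x. (\<Sum>l\<in>?I. ennreal (h x * indicator {l} (s x)) * ennreal (\<phi> l x)) \<partial>M)"
    proof (intro nn_integral_cong)
      fix x assume x: "x \<in> space M"
      have "ennreal (h x * \<phi> (s x) x) = ennreal (\<Sum>l\<in>?I. h x * \<phi> l x * indicator {l} (s x))"
        using split[OF x, of "\<lambda>x l. h x * \<phi> l x"] by simp
      also have "\<dots> = (\<Sum>l\<in>?I. ennreal (h x * \<phi> l x * indicator {l} (s x)))"
        using h0 by (intro sum_ennreal[symmetric]) (simp add: \<phi>_def)
      also have "\<dots> = (\<Sum>l\<in>?I. ennreal (h x * indicator {l} (s x)) * ennreal (\<phi> l x))"
        using h0 by (intro sum.cong refl) (simp add: \<phi>_def mult_ac flip: ennreal_mult)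
      finally show "ennreal (h x * \<phi> (s x) x) = \<dots>" .
    qed
    also have "\<dots> = (\<Sum>l\<in>?I. \<integral>\<^sup>+x. ennreal (h x * indicator {l} (s x)) * ennreal (\<phi> l x) \<partial>M)"
      unfolding \<phi>_def by (intro nn_integral_sum) measurable
    also have "\<dots> \<le> (\<Sum>l\<in>?I. \<integral>\<^sup>+x. ennreal (h x * indicator {l} (s x)) \<partial>M)"
      unfolding \<phi>_def
      by (intro sum_mono nn_integral_subgaussian_exp_const_le[OF M sub e]) measurable
    also have "\<dots> = (\<integral>\<^sup>+x. (\<Sum>l\<in>?I. ennreal (h x * indicator {l} (s x))) \<partial>M)"
      by (intro nn_integral_sum[symmetric]) measurable
    also have "\<dots> = (\<integral>\<^sup>+x. ennreal (h x) \<partial>M)"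
    proof (intro nn_integral_cong)
      fix x assume x: "x \<in> space M"
      have "(\<Sum>l\<in>?I. ennreal (h x * indicator {l} (s x))) = ennreal (\<Sum>l\<in>?I. h x * indicator {l} (s x))"
        using h0 by (intro sum_ennreal) simp
      then show "(\<Sum>l\<in>?I. ennreal (h x * indicator {l} (s x))) = ennreal (h x)"
        using split[OF x, of "\<lambda>x l. h x"] by simp
    qed
    finally show ?thesis .
  qed
  obtain s where s: "\<And>i. simple_function G (s i)" "\<And>x. x \<in> space G \<Longrightarrow> (\<lambda>i. s i x) \<longlonglongrightarrow> L x"
    using borel_measurable_implies_sequence_metric[OF L, of 0] by blast
  have sM [measurable]: "s i \<in> borel_measurable M" for i
    using measurable_from_subalg[OF M(2) borel_measurable_simple_function[OF s(1)]] .
  have "(\<integral>\<^sup>+x. ennreal (h x * \<phi> (L x) x) \<partial>M) = (\<integral>\<^sup>+x. liminf (\<lambda>i. ennreal (h x * \<phi> (s i x) x)) \<partial>M)"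
  proof (intro nn_integral_cong)
    fix x assume "x \<in> space M"
    then have "(\<lambda>i. s i x) \<longlonglongrightarrow> L x" using s(2) by (simp add: sp)
    then have "(\<lambda>i. ennreal (h x * \<phi> (s i x) x)) \<longlonglongrightarrow> ennreal (h x * \<phi> (L x) x)"
      unfolding \<phi>_def by (intro tendsto_intros tendsto_ennrealI) auto
    then show "ennreal (h x * \<phi> (L x) x) = liminf (\<lambda>i. ennreal (h x * \<phi> (s i x) x))"
      by (intro lim_imp_Liminf[symmetric]) auto
  qed
  also have "\<dots> \<le> liminf (\<lambda>i. \<integral>\<^sup>+x. ennreal (h x * \<phi> (s i x) x) \<partial>M)"
    unfolding \<phi>_def by (intro nn_integral_liminf) measurable
  also have "\<dots> \<le> liminf (\<lambda>i::nat. \<integral>\<^sup>+x. ennreal (h x) \<partial>M)"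
    by (intro Liminf_mono always_eventually allI simple s(1))
  also have "\<dots> = (\<integral>\<^sup>+x. ennreal (h x) \<partial>M)" by (intro Liminf_const) simp
  finally show ?thesis unfolding \<phi>_def .
qed

text \<open>Writing the exponent as a + sqrt q z with standard normal z covers \<open>q = 0\<close>,
  where its law has no density. Completing the square in z leaves a normal density times a
  constant.\<close>

lemma gaussian_mixture:
  fixes a q e :: real
  assumes q: "0 \<le> q"
  shows "(\<integral>\<^sup>+z. ennreal (std_normal_density z * exp ((a + sqrt q * z) * e - (a + sqrt q * z)\<^sup>2 / 2)) \<partial>lborel)
       = ennreal (exp ((2 * e * a + e\<^sup>2 * q - a\<^sup>2) / (2 * (1 + q))) / sqrt (1 + q))"
proof -
  \<comment> \<open>The coefficient of z^2 is -(1 + q) / 2 and that of z is sqrt q (e - a), which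
    determine the mean \<open>m\<close> and the deviation \<open>s\<close>.\<close>
  define m where "m = sqrt q * (e - a) / (1 + q)"
  define s where "s = 1 / sqrt (1 + q)"
  define K where "K = exp ((2 * e * a + e\<^sup>2 * q - a\<^sup>2) / (2 * (1 + q))) / sqrt (1 + q)"
  have p: "1 + q > 0" using q by simp
  have s: "s > 0" "s\<^sup>2 = 1 / (1 + q)" using p by (simp_all add: s_def power_divide)
  have K: "K \<ge> 0" using p by (simp add: K_def)
  have "std_normal_density z * exp ((a + sqrt q * z) * e - (a + sqrt q * z)\<^sup>2 / 2) = K * normal_density m s z" for z
  proof -
    have m1: "(1 + q) * m = sqrt q * (e - a)" using p by (simp add: m_def)
    have m2: "(1 + q) * m\<^sup>2 = q * (e - a)\<^sup>2 / (1 + q)"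
      using p q by (simp add: m_def power_divide power_mult_distrib) (simp add: power2_eq_square)
    have "(1 + q) * (z - m)\<^sup>2 = (1 + q) * z\<^sup>2 - 2 * z * ((1 + q) * m) + (1 + q) * m\<^sup>2"
      by (simp add: power2_eq_square algebra_simps)
    then have A: "(1 + q) * (z - m)\<^sup>2 = (1 + q) * z\<^sup>2 - 2 * z * (sqrt q * (e - a)) + q * (e - a)\<^sup>2 / (1 + q)"
      by (simp only: m1 m2)
    have B: "(2 * e * a + e\<^sup>2 * q - a\<^sup>2) / (1 + q) = q * (e - a)\<^sup>2 / (1 + q) + (2 * a * e - a\<^sup>2)"
      using p by (simp add: field_simps power2_eq_square)
    have C: "(a + sqrt q * z)\<^sup>2 = a\<^sup>2 + 2 * a * (sqrt q * z) + q * z\<^sup>2"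
      using q by (simp add: power2_sum power_mult_distrib)
    have "- z\<^sup>2 / 2 + ((a + sqrt q * z) * e - (a + sqrt q * z)\<^sup>2 / 2)
        = (2 * e * a + e\<^sup>2 * q - a\<^sup>2) / (1 + q) / 2 - (1 + q) * (z - m)\<^sup>2 / 2"
      unfolding A B C by (simp add: field_simps)
    moreover have "- (z - m)\<^sup>2 / (2 * s\<^sup>2) = - ((1 + q) * (z - m)\<^sup>2 / 2)" using p by (simp add: s(2))
    ultimately have "exp (- z\<^sup>2 / 2) * exp ((a + sqrt q * z) * e - (a + sqrt q * z)\<^sup>2 / 2)
        = exp ((2 * e * a + e\<^sup>2 * q - a\<^sup>2) / (2 * (1 + q))) * exp (- (z - m)\<^sup>2 / (2 * s\<^sup>2))"
      by (simp add: mult.commute flip: exp_add)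
    moreover have "sqrt (2 * pi * s\<^sup>2) = sqrt (2 * pi) / sqrt (1 + q)"
      by (simp add: s(2) real_sqrt_divide)
    ultimately show ?thesis
      using p by (simp add: std_normal_density_def normal_density_def K_def)
  qed
  then have "(\<integral>\<^sup>+z. ennreal (std_normal_density z * exp ((a + sqrt q * z) * e - (a + sqrt q * z)\<^sup>2 / 2)) \<partial>lborel)
      = (\<integral>\<^sup>+z. ennreal K * ennreal (normal_density m s z) \<partial>lborel)"
    using K by (simp add: ennreal_mult)
  also have "\<dots> = ennreal K * (\<integral>\<^sup>+z. ennreal (normal_density m s z) \<partial>lborel)"
    by (intro nn_integral_cmult) measurable
  also have "(\<integral>\<^sup>+z. ennreal (normal_density m s z) \<partial>lborel) = 1"
    using s(1) by (subst nn_integral_eq_integral) auto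
  finally show ?thesis by (simp add: K_def)
qed

text \<open>Tonelli's theorem puts the Gaussian integral outside; for each fixed \<open>z\<close>
  the exponent is \<open>G\<close>-measurable, so the bound for random exponents applies, and the
  density integrates to 1.\<close>

lemma subgaussian_mixture_step:
  fixes e h a q :: "'a \<Rightarrow> real"
  assumes M: "prob_space M" "subalgebra M G" and sub: "cond_subgaussian M G \<sigma> e" and \<sigma>: "\<sigma> > 0"
    and e [measurable]: "e \<in> borel_measurable M"
    and h: "h \<in> borel_measurable G" and h0: "\<And>x. 0 \<le> h x"
    and a: "a \<in> borel_measurable G"
    and q: "q \<in> borel_measurable G" and q0: "\<And>x. 0 \<le> q x"
  shows "(\<integral>\<^sup>+x. ennreal (h x * (exp ((2 * (e x / \<sigma>) * a x + (e x / \<sigma>)\<^sup>2 * q x - (a x)\<^sup>2) / (2 * (1 + q x)))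
            / sqrt (1 + q x))) \<partial>M) \<le> (\<integral>\<^sup>+x. ennreal (h x) \<partial>M)"
proof -
  interpret prob_space M by fact
  interpret pair_sigma_finite M lborel ..
  note [measurable] = measurable_from_subalg[OF M(2) h] measurable_from_subalg[OF M(2) a]
    measurable_from_subalg[OF M(2) q]
  define E where "E x z = exp ((a x + sqrt (q x) * z) * (e x / \<sigma>) - (a x + sqrt (q x) * z)\<^sup>2 / 2)" for x z
  have "(\<integral>\<^sup>+x. ennreal (h x * (exp ((2 * (e x / \<sigma>) * a x + (e x / \<sigma>)\<^sup>2 * q x - (a x)\<^sup>2) / (2 * (1 + q x)))
            / sqrt (1 + q x))) \<partial>M)
      = (\<integral>\<^sup>+x. \<integral>\<^sup>+z. ennreal (h x) * ennreal (std_normal_density z * E x z) \<partial>lborel \<partial>M)"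
  proof (intro nn_integral_cong)
    fix x
    have "(\<integral>\<^sup>+z. ennreal (h x) * ennreal (std_normal_density z * E x z) \<partial>lborel)
        = ennreal (h x) * (\<integral>\<^sup>+z. ennreal (std_normal_density z * E x z) \<partial>lborel)"
      unfolding E_def by (intro nn_integral_cmult) measurable
    also have "\<dots> = ennreal (h x) * ennreal (exp ((2 * (e x / \<sigma>) * a x + (e x / \<sigma>)\<^sup>2 * q x - (a x)\<^sup>2) / (2 * (1 + q x)))
            / sqrt (1 + q x))"
      unfolding E_def gaussian_mixture[OF q0] ..
    finally show "ennreal (h x * (exp ((2 * (e x / \<sigma>) * a x + (e x / \<sigma>)\<^sup>2 * q x - (a x)\<^sup>2) / (2 * (1 + q x)))
            / sqrt (1 + q x))) = (\<integral>\<^sup>+z. ennreal (h x) * ennreal (std_normal_density z * E x z) \<partial>lborel)"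
      by (simp only: ennreal_mult'[OF h0])
  qed
  also have "\<dots> = (\<integral>\<^sup>+z. \<integral>\<^sup>+x. ennreal (h x) * ennreal (std_normal_density z * E x z) \<partial>M \<partial>lborel)"
    unfolding E_def by (intro Fubini'[symmetric]) measurable
  also have "\<dots> \<le> (\<integral>\<^sup>+z. ennreal (std_normal_density z) * (\<integral>\<^sup>+x. ennreal (h x) \<partial>M) \<partial>lborel)"
  proof (intro nn_integral_mono)
    fix z
    \<comment> \<open>Division by \<sigma> moves the scaling from the noise to the exponent and
      cancels the variance proxy.\<close>
    let ?L = "\<lambda>x. (a x + sqrt (q x) * z) / \<sigma>"
    have "(\<integral>\<^sup>+x. ennreal (h x) * ennreal (std_normal_density z * E x z) \<partial>M)
        = (\<integral>\<^sup>+x. ennreal (std_normal_density z) * ennreal (h x * exp (?L x * e x - (?L x)\<^sup>2 * \<sigma>\<^sup>2 / 2)) \<partial>M)"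
      using h0 \<sigma>
      by (intro nn_integral_cong) (simp add: E_def power_divide mult_ac flip: ennreal_mult)
    also have "\<dots> = ennreal (std_normal_density z) * (\<integral>\<^sup>+x. ennreal (h x * exp (?L x * e x - (?L x)\<^sup>2 * \<sigma>\<^sup>2 / 2)) \<partial>M)"
      by (intro nn_integral_cmult) measurable
    also have "\<dots> \<le> ennreal (std_normal_density z) * (\<integral>\<^sup>+x. ennreal (h x) \<partial>M)"
      using a q by (intro mult_left_mono nn_integral_subgaussian_exp_le[OF M sub e h h0]) auto
    finally show "(\<integral>\<^sup>+x. ennreal (h x) * ennreal (std_normal_density z * E x z) \<partial>M)
        \<le> ennreal (std_normal_density z) * (\<integral>\<^sup>+x. ennreal (h x) \<partial>M)" .
  qed
  also have "\<dots> = (\<integral>\<^sup>+z. ennreal (std_normal_density z) \<partial>lborel) * (\<integral>\<^sup>+x. ennreal (h x) \<partial>M)"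
    by (intro nn_integral_multc) measurable
  also have "(\<integral>\<^sup>+z. ennreal (std_normal_density z) \<partial>lborel) = 1"
    by (subst nn_integral_eq_integral) auto
  finally show ?thesis by simp
qed

text \<open>Integrals with extended nonnegative values make sense before integrability is known; the
  whole space as test event then carries integrability from one time to the next.\<close>

lemma nonneg_supermartingaleI:
  fixes X :: "nat \<Rightarrow> 'a \<Rightarrow> real"
  assumes M: "prob_space M" and F: "filtration M F"
    and meas: "\<And>t. X t \<in> borel_measurable (F t)" and nonneg: "\<And>t x. 0 \<le> X t x"
    and int0: "integrable M (X 0)"
    and step: "\<And>t A. A \<in> sets (F t) \<Longrightarrow>
      (\<integral>\<^sup>+x. ennreal (indicator A x * X (Suc t) x) \<partial>M) \<le> (\<integral>\<^sup>+x. ennreal (indicator A x * X t x) \<partial>M)"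
  shows "nonneg_supermartingale M F X"
proof -
  interpret prob_space M by fact
  have sub: "subalgebra M (F t)" for t using F by (simp add: filtration_def)
  have XM [measurable]: "X t \<in> borel_measurable M" for t using measurable_from_subalg[OF sub meas] .
  have int: "integrable M (X t)" for t
  proof (induction t)
    case (Suc t)
    have "space M \<in> sets (F t)" using sub[of t] sets.top[of "F t"] by (simp add: subalgebra_def)
    from step[OF this] have "(\<integral>\<^sup>+x. ennreal (X (Suc t) x) \<partial>M) \<le> (\<integral>\<^sup>+x. ennreal (X t x) \<partial>M)"
      by (simp cong: nn_integral_cong)
    also have "\<dots> < \<infinity>" using Suc nonneg by (simp add: integrable_iff_bounded)
    finally show ?case using nonneg by (simp add: integrable_iff_bounded)
  qed (rule int0)
  have "AE x in M. real_cond_exp M (F t) (X (Suc t)) x \<le> X t x" for t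
  proof -
    interpret finite_measure_subalgebra M "F t" by unfold_locales (rule sub)
    let ?Y = "real_cond_exp M (F t) (X (Suc t))"
    \<comment> \<open>The event on which the inequality fails lies in \<open>F t\<close>. The excess
      is nonnegative there and has integral at most 0, so it vanishes almost everywhere.\<close>
    define A where "A = {x \<in> space (F t). X t x < ?Y x}"
    have A: "A \<in> sets (F t)" unfolding A_def using meas[of t] by measurable
    then have AM [measurable]: "A \<in> sets M" using sub[of t] by (auto simp: subalgebra_def)
    have sp: "space (F t) = space M" using sub by (simp add: subalgebra_def)
    have iY: "integrable M ?Y" by (rule real_cond_exp_int(1)[OF int])
    have iAX: "integrable M (\<lambda>x. indicator A x * X s x)" for s
      using integrable_mult_indicator[OF AM int[of s]] by simp
    have iAY: "integrable M (\<lambda>x. indicator A x * ?Y x)"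
      using integrable_mult_indicator[OF AM iY] by simp
    have "(\<integral>x. indicator A x * ?Y x \<partial>M) = (\<integral>x. indicator A x * X (Suc t) x \<partial>M)"
      using real_cond_exp_intA[OF int[of "Suc t"] A] by (simp add: set_lebesgue_integral_def)
    also have "\<dots> \<le> (\<integral>x. indicator A x * X t x \<partial>M)"
    proof -
      have "ennreal (\<integral>x. indicator A x * X (Suc t) x \<partial>M) \<le> ennreal (\<integral>x. indicator A x * X t x \<partial>M)"
        using step[OF A] iAX nonneg by (simp add: nn_integral_eq_integral)
      then show ?thesis using nonneg by (simp add: ennreal_le_iff integral_nonneg_AE)
    qed
    finally have "(\<integral>x. indicator A x * ?Y x - indicator A x * X t x \<partial>M) \<le> 0"
      using iAX iAY by simp
    moreover have nn: "0 \<le> indicator A x * ?Y x - indicator A x * X t x" for x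
      by (auto simp: A_def indicator_def)
    ultimately have "(\<integral>x. indicator A x * ?Y x - indicator A x * X t x \<partial>M) = 0"
      by (intro antisym Bochner_Integration.integral_nonneg) auto
    then have "AE x in M. indicator A x * ?Y x - indicator A x * X t x = 0"
      using iAX iAY nn by (subst (asm) integral_nonneg_eq_0_iff_AE) auto
    then show ?thesis
      using AE_space by eventually_elim (auto simp: A_def sp indicator_def split: if_splits)
  qed
  then show ?thesis using meas int nonneg by (simp add: nonneg_supermartingale_def)
qed

text \<open>Stopping at the first crossing, expressed without stopping times: paths that have
  crossed are charged the level \<open>c\<close>, and the others keep their current value. This
  total never exceeds the initial expectation, and continuity from below passes to an infinite
  horizon.\<close>

lemma Ville_inequality:
  fixes X :: "nat \<Rightarrow> 'a \<Rightarrow> real"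
  assumes M: "prob_space M" and F: "filtration M F" and X: "nonneg_supermartingale M F X" and c: "c > 0"
  shows "measure M {x \<in> space M. \<exists>t. X t x > c} \<le> (\<integral>x. X 0 x \<partial>M) / c"
proof -
  interpret prob_space M by fact
  have sub: "subalgebra M (F t)" for t using F by (simp add: filtration_def)
  have sp: "space (F t) = space M" for t using sub by (simp add: subalgebra_def)
  have meas: "X t \<in> borel_measurable (F t)" and int: "integrable M (X t)"
    and nonneg: "x \<in> space M \<Longrightarrow> 0 \<le> X t x" for t x
    using X by (auto simp: nonneg_supermartingale_def)
  have XM [measurable]: "X t \<in> borel_measurable M" for t using measurable_from_subalg[OF sub meas] .
  have XF: "X s \<in> borel_measurable (F t)" if "s \<le> t" for s t
  proof (rule measurable_from_subalg[OF _ meas])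
    show "subalgebra (F t) (F s)" using F that by (auto simp: filtration_def subalgebra_def sp)
  qed
  define N where "N n = {x \<in> space M. \<forall>t\<le>n. X t x \<le> c}" for n
  have NF: "N n \<in> sets (F n)" for n
  proof -
    have "N n = {x \<in> space (F n). \<forall>t\<in>{..n}. X t x \<le> c}" by (auto simp: N_def sp)
    also have "\<dots> \<in> sets (F n)"
      by (intro sets.sets_Collect_finite_All borel_measurable_le XF) auto
    finally show ?thesis .
  qed
  have NM [measurable]: "N n \<in> sets M" for n using NF[of n] sub[of n] by (auto simp: subalgebra_def)
  have super: "(\<integral>x\<in>A. X (Suc n) x \<partial>M) \<le> (\<integral>x\<in>A. X n x \<partial>M)" if A: "A \<in> sets (F n)" for A n
  proof -
    interpret finite_measure_subalgebra M "F n" by unfold_locales (rule sub)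
    have AM: "A \<in> sets M" using A sub[of n] by (auto simp: subalgebra_def)
    have "(\<integral>x\<in>A. X (Suc n) x \<partial>M) = (\<integral>x\<in>A. real_cond_exp M (F n) (X (Suc n)) x \<partial>M)"
      by (rule real_cond_exp_intA[OF int A])
    also have "\<dots> \<le> (\<integral>x\<in>A. X n x \<partial>M)"
      unfolding set_lebesgue_integral_def
    proof (intro integral_mono_AE integrable_mult_indicator AM int real_cond_exp_int(1))
      have "AE x in M. real_cond_exp M (F n) (X (Suc n)) x \<le> X n x"
        using X by (auto simp: nonneg_supermartingale_def)
      then show "AE x in M. indicat_real A x *\<^sub>R real_cond_exp M (F n) (X (Suc n)) x \<le> indicat_real A x *\<^sub>R X n x"
        by eventually_elim (auto simp: indicator_def)
    qed
    finally show ?thesis .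
  qed
  have si: "set_integrable M A (X n)" if "A \<in> sets M" for A n
    unfolding set_integrable_def using integrable_mult_indicator[OF that int] .
  have exceed: "c * measure M A \<le> (\<integral>x\<in>A. X n x \<partial>M)" if A: "A \<in> sets M" "\<And>x. x \<in> A \<Longrightarrow> c < X n x" for A n
  proof -
    have "c * measure M A = (\<integral>x\<in>A. c \<partial>M)" using A by (simp add: set_lebesgue_integral_def mult.commute)
    also have "\<dots> \<le> (\<integral>x\<in>A. X n x \<partial>M)"
      using A integrable_mult_indicator[OF A(1), of "\<lambda>_. c"]
      by (intro set_integral_mono si) (auto simp: set_integrable_def less_imp_le)
    finally show ?thesis .
  qed
  have split: "c * measure M (A - B) + (\<integral>x\<in>B. X n x \<partial>M) \<le> (\<integral>x\<in>A. X n x \<partial>M)"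
    if "A \<in> sets M" "B \<in> sets M" "B \<subseteq> A" "\<And>x. x \<in> A - B \<Longrightarrow> c < X n x" for A B n
  proof -
    have "(\<integral>x\<in>(A - B) \<union> B. X n x \<partial>M) = (\<integral>x\<in>A - B. X n x \<partial>M) + (\<integral>x\<in>B. X n x \<partial>M)"
      using that by (intro set_integral_Un si) auto
    moreover have "(A - B) \<union> B = A" using that by auto
    ultimately show ?thesis using exceed[of "A - B" n] that by auto
  qed
  \<comment> \<open>In the step, the supermartingale property is used on \<open>N n\<close>, which
    is known at time \<open>n\<close>; \<open>split\<close> then separates the paths that cross at
    time n + 1.\<close>
  have bound: "c * measure M (space M - N n) + (\<integral>x\<in>N n. X n x \<partial>M) \<le> (\<integral>x. X 0 x \<partial>M)" for n
  proof (induction n)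
    case 0
    have "(\<integral>x\<in>space M. X 0 x \<partial>M) = (\<integral>x. X 0 x \<partial>M)" by (rule set_integral_space[OF int])
    moreover have "c < X 0 x" if "x \<in> space M - N 0" for x using that by (auto simp: N_def)
    ultimately show ?case using split[of "space M" "N 0" 0] NM[THEN sets.sets_into_space] by auto
  next
    case (Suc n)
    have sub: "N (Suc n) \<subseteq> N n" by (auto simp: N_def)
    have "space M - N (Suc n) = (space M - N n) \<union> (N n - N (Suc n))"
      using sub by (auto simp: N_def)
    then have "measure M (space M - N (Suc n)) = measure M (space M - N n) + measure M (N n - N (Suc n))"
      by (simp only:) (rule finite_measure_Union, auto)
    moreover have "c * measure M (N n - N (Suc n)) + (\<integral>x\<in>N (Suc n). X (Suc n) x \<partial>M) \<le> (\<integral>x\<in>N n. X (Suc n) x \<partial>M)"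
      using sub by (intro split) (auto simp: N_def le_Suc_eq not_le)
    ultimately show ?case using Suc super[OF NF[of n]] by (simp add: distrib_left)
  qed
  have le: "measure M (space M - N n) \<le> (\<integral>x. X 0 x \<partial>M) / c" for n
  proof -
    have "0 \<le> (\<integral>x\<in>N n. X n x \<partial>M)"
      unfolding set_lebesgue_integral_def using nonneg
      by (intro integral_nonneg_AE AE_I2) (auto simp: indicator_def)
    then show ?thesis using bound[of n] c by (simp add: field_simps)
  qed
  have "(\<lambda>n. measure M (space M - N n)) \<longlonglongrightarrow> measure M (\<Union>n. space M - N n)"
  proof (rule finite_Lim_measure_incseq)
    show "incseq (\<lambda>n. space M - N n)"
    proof (rule incseq_SucI)
      fix n
      have "N (Suc n) \<subseteq> N n" by (auto simp: N_def)
      then show "space M - N n \<subseteq> space M - N (Suc n)" by blast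
    qed
  qed auto
  then have "measure M (\<Union>n. space M - N n) \<le> (\<integral>x. X 0 x \<partial>M) / c"
    using le by (intro LIMSEQ_le_const2) auto
  also have "(\<Union>n. space M - N n) = {x \<in> space M. \<exists>t. X t x > c}"
  proof (intro equalityI subsetI)
    fix x assume "x \<in> {x \<in> space M. \<exists>t. X t x > c}"
    then obtain t where "x \<in> space M" "c < X t x" by blast
    then have "x \<in> space M - N t" by (auto simp: N_def not_le)
    then show "x \<in> (\<Union>n. space M - N n)" by blast
  qed (auto simp: N_def not_le)
  finally show ?thesis .
qed

subsection \<open>The self-normalised process\<close>

text \<open>The recursion closes on the scalar forms <f_i, R_t f_j>, so vector-valued measurability
  is needed only for the f_i themselves. The horizon \<open>n\<close> may exceed \<open>t\<close>,
  because the update pairs R_t with f_{t+1}.\<close>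

lemma borel_measurable_inner_resolvent:
  fixes f :: "nat \<Rightarrow> 'a \<Rightarrow> 'h::real_inner"
  assumes sep: "\<exists>D::'h set. countable D \<and> closure D = UNIV"
    and f: "\<And>s. s \<in> {1..n} \<Longrightarrow> f s \<in> borel_measurable N"
    and "t \<le> n" "i \<in> {1..n}" "j \<in> {1..n}"
  shows "(\<lambda>x. f i x \<bullet> resolvent \<rho> (\<lambda>s. f s x) t (f j x)) \<in> borel_measurable N"
  using assms(3-)
proof (induction t arbitrary: i j)
  case 0
  then have "(\<lambda>x. f i x \<bullet> f j x) \<in> borel_measurable N"
    by (intro borel_measurable_inner_separable[OF sep] f)
  then show ?case by simp
next
  case (Suc t)
  have [measurable]: "(\<lambda>x. f i x \<bullet> resolvent \<rho> (\<lambda>s. f s x) t (f j x)) \<in> borel_measurable N"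
    if "i \<in> {1..n}" "j \<in> {1..n}" for i j
    using Suc.IH[OF _ that] Suc.prems(1) by simp
  have "Suc t \<in> {1..n}" using Suc.prems by simp
  with Suc.prems(2,3) show ?case
    by (simp add: inner_diff_right)
qed

lemma borel_measurable_inner_resolvent_sum:
  fixes f :: "nat \<Rightarrow> 'a \<Rightarrow> 'h::real_inner"
  assumes sep: "\<exists>D::'h set. countable D \<and> closure D = UNIV"
    and f: "\<And>s. s \<in> {1..n} \<Longrightarrow> f s \<in> borel_measurable N"
    and t: "t \<le> n" and J: "J \<subseteq> {1..n}" and I: "I \<subseteq> {1..n}"
    and c: "\<And>i. i \<in> I \<Longrightarrow> c i \<in> borel_measurable N" and d: "\<And>j. j \<in> J \<Longrightarrow> d j \<in> borel_measurable N"
  shows "(\<lambda>x. (\<Sum>i\<in>I. c i x *\<^sub>R f i x) \<bullet> resolvent \<rho> (\<lambda>s. f s x) t (\<Sum>j\<in>J. d j x *\<^sub>R f j x))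
    \<in> borel_measurable N"
proof -
  have "(\<lambda>x. \<Sum>j\<in>J. \<Sum>i\<in>I. d j x * (c i x * (f i x \<bullet> resolvent \<rho> (\<lambda>s. f s x) t (f j x))))
      \<in> borel_measurable N"
    using I J t
    by (intro borel_measurable_sum borel_measurable_times c d borel_measurable_inner_resolvent[OF sep f]) auto
  then show ?thesis
    by (simp add: linear_sum[OF linear_resolvent] linear_scale[OF linear_resolvent] inner_sum_left
        inner_sum_right sum_distrib_left)
qed

theorem theorem1:
  fixes M :: "'a measure" and F :: "nat \<Rightarrow> 'a measure"
    and f :: "nat \<Rightarrow> 'a \<Rightarrow> 'h::{real_inner, complete_space}"
    and \<epsilon> :: "nat \<Rightarrow> 'a \<Rightarrow> real" and \<sigma> \<rho> :: real
  assumes separable: "\<exists>D::'h set. countable D \<and> closure D = UNIV"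
    and prob: "prob_space M"
    and filt: "filtration M F"
    and predictable: "\<And>t. t \<ge> 1 \<Longrightarrow> f t \<in> borel_measurable (F (t - 1))"
    and adapted: "\<And>t. t \<ge> 1 \<Longrightarrow> \<epsilon> t \<in> borel_measurable (F t)"
    and subg: "\<And>t. t \<ge> 1 \<Longrightarrow> cond_subgaussian M (F (t - 1)) \<sigma> (\<epsilon> t)"
    and sigma_pos: "\<sigma> > 0"
    and rho_pos: "\<rho> > 0"
  defines "S \<equiv> (\<lambda>t x. \<Sum>s\<in>{1..t}. \<epsilon> s x *\<^sub>R f s x)"
    and "V \<equiv> (\<lambda>t x. \<lambda>h. \<Sum>s\<in>{1..t}. rank_one (f s x) (f s x) h)"
  shows "nonneg_supermartingale M F
           (\<lambda>t x. 1 / sqrt (fredholm_det_id_plus (\<lambda>h. (1 / \<rho>) *\<^sub>R V t x h))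
                  * exp (1/2 * (norm (inv_sqrt_op (\<lambda>h. \<rho> *\<^sub>R h + V t x h) ((1 / \<sigma>) *\<^sub>R S t x)))\<^sup>2))
       \<and> (\<forall>\<delta>. 0 < \<delta> \<and> \<delta> < 1 \<longrightarrow>
           (\<exists>A\<in>sets M. measure M A \<ge> 1 - \<delta> \<and>
              (\<forall>x\<in>A. \<forall>t\<ge>1.
                 norm (inv_sqrt_op (\<lambda>h. V t x h + \<rho> *\<^sub>R h) (S t x))
                   \<le> \<sigma> * sqrt (2 * ln (1 / \<delta> * sqrt (fredholm_det_id_plus (\<lambda>h. (1 / \<rho>) *\<^sub>R V t x h)))))))"
proof -
  interpret prob_space M by (rule prob)
  have sub: "subalgebra M (F t)" for t using filt by (simp add: filtration_def)
  have mono: "u \<in> borel_measurable (F t)" if "u \<in> borel_measurable (F s)" "s \<le> t"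
    for u :: "'a \<Rightarrow> 'b::topological_space" and s t
  proof (rule measurable_from_subalg[OF _ that(1)])
    show "subalgebra (F t) (F s)"
      using filt that(2) by (auto simp: filtration_def subalgebra_def)
  qed
  \<comment> \<open>The range reaches \<open>Suc t\<close> because predictability makes f_{t+1}
    known at time \<open>t\<close>.\<close>
  have fF: "f s \<in> borel_measurable (F t)" if "s \<in> {1..Suc t}" for s t
    using mono[OF predictable[of s], of t] that by auto
  have eF: "\<epsilon> s \<in> borel_measurable (F t)" if "s \<in> {1..t}" for s t
    using mono[OF adapted[of s], of t] that by auto
  define R where "R t x = resolvent \<rho> (\<lambda>s. f s x) t" for t x
  define Z where "Z t x = (1 / \<sigma>) *\<^sub>R S t x" for t x
  define q where "q t x = f (Suc t) x \<bullet> R t x (f (Suc t) x)" for t x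
  define a where "a t x = f (Suc t) x \<bullet> R t x (Z t x)" for t x
  define Q where "Q t x = Z t x \<bullet> R t x (Z t x)" for t x
  define D where "D t x = (\<Prod>s<t. 1 + q s x)" for t x
  \<comment> \<open>The process freed of eigenvalues and operator roots; \<open>det\<close> and
    \<open>norm_sq\<close> identify it with the original one.\<close>
  define X where "X t x = 1 / sqrt (D t x) * exp (1 / 2 * Q t x)" for t x
  have V: "V t x = gram_op (\<lambda>s. f s x) t" for t x
    by (auto simp: V_def gram_op_def rank_one_def)
  have det: "fredholm_det_id_plus (\<lambda>h. (1 / \<rho>) *\<^sub>R V t x h) = D t x" for t x
    unfolding V fredholm_det_gram_op[OF rho_pos] D_def q_def R_def ..
  have norm_sq: "(norm (inv_sqrt_op (\<lambda>h. \<rho> *\<^sub>R h + V t x h) y))\<^sup>2 = y \<bullet> R t x y" for t x y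
    unfolding V R_def by (rule norm_inv_sqrt_op_gram_op[OF rho_pos])
  have q0: "0 \<le> q t x" for t x unfolding q_def R_def by (rule resolvent_nonneg[OF rho_pos])
  have D1: "1 \<le> D t x" for t x unfolding D_def using q0 by (intro prod_ge_1) auto
  have X0: "0 \<le> X t x" for t x using D1[of t x] by (simp add: X_def)
  have Z_eq: "Z t x = (\<Sum>s\<in>{1..t}. (\<epsilon> s x / \<sigma>) *\<^sub>R f s x)" for t x
    by (simp add: Z_def S_def scaleR_sum_right)
  have qF: "q t \<in> borel_measurable (F t)" for t
    unfolding q_def R_def by (rule borel_measurable_inner_resolvent[OF separable, of "Suc t"]) (auto intro: fF)
  have aF: "a t \<in> borel_measurable (F t)" for t
  proof -
    \<comment> \<open>A singleton sum with coefficient 1 brings f_{t+1} into the bilinear form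
      already handled.\<close>
    have "(\<lambda>x. (\<Sum>i\<in>{Suc t}. 1 *\<^sub>R f i x) \<bullet> R t x (Z t x)) \<in> borel_measurable (F t)"
      unfolding R_def Z_eq
      by (rule borel_measurable_inner_resolvent_sum[OF separable, of "Suc t" _ _ _ _ _ "\<lambda>_ _. 1"])
        (auto intro!: fF borel_measurable_divide eF)
    then show ?thesis by (simp add: a_def[abs_def])
  qed
  have QF: "Q t \<in> borel_measurable (F t)" for t
    unfolding Q_def R_def Z_eq
    by (rule borel_measurable_inner_resolvent_sum[OF separable, of t])
      (auto intro!: fF borel_measurable_divide eF)
  have XF: "X t \<in> borel_measurable (F t)" for t
  proof -
    have "q s \<in> borel_measurable (F t)" if "s < t" for s using mono[OF qF] that by simp
    then have "D t \<in> borel_measurable (F t)" unfolding D_def by (intro borel_measurable_prod) auto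
    then show ?thesis unfolding X_def using QF[of t] by measurable
  qed
  have X_Suc: "X (Suc t) x = X t x * (exp ((2 * (\<epsilon> (Suc t) x / \<sigma>) * a t x
      + (\<epsilon> (Suc t) x / \<sigma>)\<^sup>2 * q t x - (a t x)\<^sup>2) / (2 * (1 + q t x))) / sqrt (1 + q t x))" for t x
  proof -
    let ?r = "(2 * (\<epsilon> (Suc t) x / \<sigma>) * a t x + (\<epsilon> (Suc t) x / \<sigma>)\<^sup>2 * q t x - (a t x)\<^sup>2) / (1 + q t x)"
    have "Z (Suc t) x = Z t x + (\<epsilon> (Suc t) x / \<sigma>) *\<^sub>R f (Suc t) x" by (simp add: Z_eq)
    then have "Q (Suc t) x = Q t x + ?r"
      unfolding Q_def R_def a_def q_def
      using resolvent_quadratic_update[OF rho_pos, where g = "\<lambda>s. f s x" and t = t] by (simp only:)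
    then have "exp (1 / 2 * Q (Suc t) x) = exp (1 / 2 * Q t x) * exp (?r / 2)"
      by (simp add: add_divide_distrib exp_add)
    moreover have "sqrt (D (Suc t) x) = sqrt (D t x) * sqrt (1 + q t x)"
      by (simp add: D_def real_sqrt_mult)
    ultimately show ?thesis by (simp add: X_def mult.commute)
  qed
  have X_0: "X 0 x = 1" for x by (simp add: X_def D_def Q_def Z_eq)
  have X: "nonneg_supermartingale M F X"
  proof (rule nonneg_supermartingaleI[OF prob filt XF X0])
    have "X 0 = (\<lambda>_. 1)" using X_0 by blast
    then show "integrable M (X 0)" by simp
    fix t A assume A: "A \<in> sets (F t)"
    have e: "\<epsilon> (Suc t) \<in> borel_measurable M"
      using measurable_from_subalg[OF sub adapted[of "Suc t"]] by simp
    have sg: "cond_subgaussian M (F t) \<sigma> (\<epsilon> (Suc t))" using subg[of "Suc t"] by simp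
    \<comment> \<open>With this weight the mixture bound becomes the supermartingale inequality
      tested on the event \<open>A\<close>.\<close>
    have "(\<lambda>x. indicator A x * X t x) \<in> borel_measurable (F t)" using A XF[of t] by measurable
    from subgaussian_mixture_step[OF prob sub sg sigma_pos e this _ aF qF q0]
    show "(\<integral>\<^sup>+x. ennreal (indicator A x * X (Suc t) x) \<partial>M) \<le> (\<integral>\<^sup>+x. ennreal (indicator A x * X t x) \<partial>M)"
      using X0 by (simp only: X_Suc mult.assoc) simp
  qed
  have X_M [measurable]: "X t \<in> borel_measurable M" for t using measurable_from_subalg[OF sub XF] .
  have bound: "\<exists>A\<in>sets M. measure M A \<ge> 1 - \<delta> \<and> (\<forall>x\<in>A. \<forall>t\<ge>1.
      norm (inv_sqrt_op (\<lambda>h. V t x h + \<rho> *\<^sub>R h) (S t x)) \<le> \<sigma> * sqrt (2 * ln (1 / \<delta> * sqrt (D t x))))"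
    if \<delta>: "0 < \<delta>" "\<delta> < 1" for \<delta>
  proof -
    \<comment> \<open>The process starts at 1, so it ever exceeds this level with probability at
      most \<delta>.\<close>
    define E where "E = {x \<in> space M. \<exists>t. X t x > 1 / \<delta>}"
    have E [measurable]: "E \<in> sets M" unfolding E_def by measurable
    have "measure M E \<le> \<delta>"
      using Ville_inequality[OF prob filt X, of "1 / \<delta>"] \<delta> prob_space by (simp add: E_def X_0)
    then have "1 - \<delta> \<le> measure M (space M - E)" by (simp add: prob_compl)
    moreover have "norm (inv_sqrt_op (\<lambda>h. V t x h + \<rho> *\<^sub>R h) (S t x)) \<le> \<sigma> * sqrt (2 * ln (1 / \<delta> * sqrt (D t x)))"
      if x: "x \<in> space M - E" for x t
    proof -
      have Dp: "sqrt (D t x) > 0" using D1[of t x] by simp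
      have "X t x \<le> 1 / \<delta>" using x by (auto simp: E_def not_less)
      then have "exp (1 / 2 * Q t x) \<le> 1 / \<delta> * sqrt (D t x)"
        using Dp by (simp add: X_def field_simps)
      then have "1 / 2 * Q t x \<le> ln (1 / \<delta> * sqrt (D t x))"
        using Dp \<delta> by (subst ln_ge_iff) auto
      moreover have "S t x \<bullet> R t x (S t x) = \<sigma>\<^sup>2 * Q t x"
        using sigma_pos
        by (simp add: Q_def Z_def R_def linear_scale[OF linear_resolvent] power2_eq_square)
      ultimately have "S t x \<bullet> R t x (S t x) \<le> \<sigma>\<^sup>2 * (2 * ln (1 / \<delta> * sqrt (D t x)))"
        by (simp add: mult_left_mono)
      then have "(norm (inv_sqrt_op (\<lambda>h. V t x h + \<rho> *\<^sub>R h) (S t x)))\<^sup>2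
          \<le> \<sigma>\<^sup>2 * (2 * ln (1 / \<delta> * sqrt (D t x)))"
        using norm_sq[of t x "S t x"] by (simp add: add.commute)
      then have "norm (inv_sqrt_op (\<lambda>h. V t x h + \<rho> *\<^sub>R h) (S t x))
          \<le> sqrt (\<sigma>\<^sup>2 * (2 * ln (1 / \<delta> * sqrt (D t x))))"
        by (rule real_le_rsqrt)
      then show ?thesis using sigma_pos by (simp add: real_sqrt_mult)
    qed
    ultimately show ?thesis by (intro bexI[of _ "space M - E"]) auto
  qed
  have "(\<lambda>t x. 1 / sqrt (fredholm_det_id_plus (\<lambda>h. (1 / \<rho>) *\<^sub>R V t x h))
      * exp (1/2 * (norm (inv_sqrt_op (\<lambda>h. \<rho> *\<^sub>R h + V t x h) ((1 / \<sigma>) *\<^sub>R S t x)))\<^sup>2)) = X"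
    unfolding det norm_sq X_def Q_def Z_def ..
  with X bound show ?thesis unfolding det by auto
qed

end
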